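(* Fix an integer $n \geq 2$. Let $P \sim P(n,m)$ be the convex hull of the random points $a_1,\dots,a_m$, and let $v$ be a random vector on the unit sphere $S^{n-1}$. Then the expected number of pivot steps required by the shadow-vertex algorithm to solve the linear programming problem $$\text{maximize } \langle v, x\rangle \text{ subject to } \langle a_1, x\rangle \leq 1, \ \dots,\ \langle a_m, x\rangle \leq 1$$ is $\tilde{O}(m^{1/(n-1)})$ as $m \to \infty$; that is, there are constants $C$ and $k$ depending only on $n$ such that this expectation is at most $C\, m^{1/(n-1)} (\log m)^k$ for all sufficiently large $m$.
   Context: $P(n,m)$ denotes the distribution of the convex hull $P$ of $m$ points $a_1,\dots,a_m$ chosen independently and uniformly at random from the unit sphere $S^{n-1} \subset \mathbb{R}^n$. The vector $v$ is uniformly distributed on $S^{n-1}$ and independent of $a_1,\dots,a_m$. The algorithm is used in its dual description. Let $CH$ denote convex hull, $Y = CH(0,a_1,\dots,a_m)$, let $\mathbb{R}^+ w$ denote the ray spanned by a vector $w$, let $e_1,\dots,e_n$ be the standard basis of $\mathbb{R}^n$, and let $\Pi_k : \mathbb{R}^n \to \mathbb{R}^k$ be the projection omitting the last $n-k$ coordinates. In the dual description, solving the linear program means finding the facet of $Y$ spanned by $n$ of the points $a_i$ through which the ray $\mathbb{R}^+ v$ passes, or determining that no such facet exists. Below, points are relabelled as the algorithm proceeds and a simplex spanned by points $a_i$ is identified with its image under the projection $\Pi_k$ in question. Shadow-vertex algorithm: (1) Apply the standard simplex algorithm to the polygon $\Pi_2(Y)$ with objective $\Pi_2(v)$, i.e.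 move from edge to adjacent edge of the polygon until finding an edge $CH(a_1,a_2)$ intersected by $\mathbb{R}^+\Pi_2(v)$. If no such edge exists, report that there is no solution and stop. (2) For $k = 3,\dots,n$ successively: (a) take the optimal simplex $CH(a_1,\dots,a_{k-1})$ found at the previous stage, which corresponds to a $(k-2)$-dimensional face of $\Pi_k(Y)$, and find a boundary simplex $CH(a_1,\dots,a_{k-1},a_k^* )$ of $\Pi_k(Y)$ containing it; (b) let $C_k$ be the polygon obtained by intersecting $\Pi_k(Y)$ with the plane $\operatorname{span}(\Pi_k(e_k),\Pi_k(v))$; starting from the edge of $C_k$ determined by $CH(a_1,\dots,a_{k-1},a_k^* )$, take pivot steps in $C_k$ (moves from an edge of $C_k$ to an adjacent edge, walking around the polygon without revisiting edges) until finding an edge intersected by $\mathbb{R}^+\Pi_k(v)$. If no such edge exists, report that there is no solution and stop. Otherwise this edge corresponds to a facet of $\Pi_k(Y)$ intersected by $\mathbb{R}^+\Pi_k(v)$, which is the optimal simplex for the next stage. (3) Return the optimal simplex $CH(a_1,\dots,a_n)$. The number of pivot steps is the total number of edge-to-adjacent-edge moves, over the polygon $\Pi_2(Y)$ and the polygons $C_3,\dots,C_n$. *)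

theory Defs
  imports "HOL-Analysis.Analysis" "HOL-Probability.Probability"
begin

text \<open>
  Normalised surface measure on the unit sphere as cone measure: the measure of \<open>A\<close> is the
  fraction of the unit ball lying on the rays through \<open>A\<close>. (The centre of the ball, where
  normalisation is meaningless, is a null set.)
\<close>
definition uniform_sphere :: "(real ^ 'n) measure" where
  "uniform_sphere = distr (uniform_measure lborel (ball 0 1)) borel (\<lambda>x. x /\<^sub>R norm x)"

text \<open>
  Throughout, \<open>e 1, \<dots>, e n\<close> enumerates the standard basis of \<open>\<real>\<^sup>n\<close>. The target \<open>\<real>\<^sup>k\<close> of the
  projection \<open>\<Pi>\<^sub>k\<close> is identified with the coordinate subspace spanned by \<open>e 1, \<dots>, e k\<close>, so that
  all the projected polytopes live in one type. Faces, edges and facets are notions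
  relative to the affine hull, so they are not affected by this identification.
\<close>
definition proj :: "(nat \<Rightarrow> real ^ 'n) \<Rightarrow> nat \<Rightarrow> real ^ 'n \<Rightarrow> real ^ 'n" where
  "proj e k x = (\<Sum>j=1..k. (x \<bullet> e j) *\<^sub>R e j)"

text \<open>
  The ray is open at the origin: the origin lies in \<open>Y\<close>, possibly on its boundary, and an
  edge with endpoint \<open>0\<close> must not count as being crossed merely because it contains \<open>0\<close>.
\<close>
definition ray :: "real ^ 'n \<Rightarrow> (real ^ 'n) set" where
  "ray w = {t *\<^sub>R w |t. t > 0}"

definition Y :: "nat \<Rightarrow> (nat \<Rightarrow> real ^ 'n) \<Rightarrow> (real ^ 'n) set" where
  "Y m a = convex hull (insert 0 (a ` {1..m}))"

definition projY :: "(nat \<Rightarrow> real ^ 'n) \<Rightarrow> nat \<Rightarrow> (nat \<Rightarrow> real ^ 'n) \<Rightarrow> nat \<Rightarrow> (real ^ 'n) set" where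
  "projY e m a k = proj e k ` Y m a"

text \<open>The points \<open>a i\<close> are kept under their original labels; a simplex is given by its index set.\<close>
definition simplex_image ::
    "(nat \<Rightarrow> real ^ 'n) \<Rightarrow> (nat \<Rightarrow> real ^ 'n) \<Rightarrow> nat \<Rightarrow> nat set \<Rightarrow> (real ^ 'n) set" where
  "simplex_image e a k I = proj e k ` (convex hull (a ` I))"

definition section_plane :: "(nat \<Rightarrow> real ^ 'n) \<Rightarrow> real ^ 'n \<Rightarrow> nat \<Rightarrow> (real ^ 'n) set" where
  "section_plane e v k = span {proj e k (e k), proj e k v}"

definition section_polygon ::
    "(nat \<Rightarrow> real ^ 'n) \<Rightarrow> nat \<Rightarrow> (nat \<Rightarrow> real ^ 'n) \<Rightarrow> real ^ 'n \<Rightarrow> nat \<Rightarrow> (real ^ 'n) set" where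
  "section_polygon e m a v k = projY e m a k \<inter> section_plane e v k"

definition adjacent_edges :: "(real ^ 'n) set \<Rightarrow> (real ^ 'n) set \<Rightarrow> bool" where
  "adjacent_edges E F \<longleftrightarrow> E \<noteq> F \<and> E \<inter> F \<noteq> {}"

text \<open>
  The list of edges visited by moving around the polygon \<open>C\<close>, without revisiting an edge
  and without moving on from an edge that meets \<open>R\<close>. It comprises
  \<open>length Es - 1\<close> pivot steps.
\<close>
definition polygon_walk :: "(real ^ 'n) set \<Rightarrow> (real ^ 'n) set \<Rightarrow> (real ^ 'n) set list \<Rightarrow> bool" where
  "polygon_walk C R Es \<longleftrightarrow>
     Es \<noteq> [] \<and> distinct Es \<and> (\<forall>E\<in>set Es. E edge_of C) \<and> successively adjacent_edges Es \<and>
     (\<forall>E\<in>set (butlast Es). E \<inter> R = {})"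

definition successful_walk :: "(real ^ 'n) set \<Rightarrow> (real ^ 'n) set \<Rightarrow> (real ^ 'n) set list \<Rightarrow> bool" where
  "successful_walk C R Es \<longleftrightarrow> polygon_walk C R Es \<and> last Es \<inter> R \<noteq> {}"

text \<open>Absence of an edge meeting \<open>R\<close> is reported once all the edges have been visited.\<close>
definition unsuccessful_walk :: "(real ^ 'n) set \<Rightarrow> (real ^ 'n) set \<Rightarrow> (real ^ 'n) set list \<Rightarrow> bool" where
  "unsuccessful_walk C R Es \<longleftrightarrow>
     polygon_walk C R Es \<and> last Es \<inter> R = {} \<and> set Es = {E. E edge_of C}"

text \<open>
  The possible starting edges of the walk in \<open>C\<^sub>k\<close>, given that the previous stage ended
  with the simplex \<open>I\<close>; the new index \<open>j\<close> is that of \<open>a\<^sub>k\<^sup>*\<close>.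
\<close>
definition start_edge ::
    "(nat \<Rightarrow> real ^ 'n) \<Rightarrow> nat \<Rightarrow> (nat \<Rightarrow> real ^ 'n) \<Rightarrow> real ^ 'n \<Rightarrow> nat \<Rightarrow> nat set \<Rightarrow> (real ^ 'n) set \<Rightarrow> bool" where
  "start_edge e m a v k I E \<longleftrightarrow>
     (\<exists>j\<in>{1..m} - I. simplex_image e a k (insert j I) facet_of projY e m a k \<and>
        E = simplex_image e a k (insert j I) \<inter> section_plane e v k)"

text \<open>
  \<open>optimal_simplex e m a v k I N\<close>: some execution on the input \<open>(a 1, \<dots>, a m; v)\<close> completes the
  stage in dimension \<open>k\<close> with optimal simplex \<open>I\<close>, having made \<open>N\<close> pivot steps so far. It is a
  relation since the initial edge, the point \<open>a\<^sub>k\<^sup>*\<close> and the direction of a walk are left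
  open by the algorithm.
\<close>
inductive optimal_simplex ::
    "(nat \<Rightarrow> real ^ 'n) \<Rightarrow> nat \<Rightarrow> (nat \<Rightarrow> real ^ 'n) \<Rightarrow> real ^ 'n \<Rightarrow> nat \<Rightarrow> nat set \<Rightarrow> nat \<Rightarrow> bool"
  for e m a v where
  first_stage:
    "\<lbrakk>successful_walk (projY e m a 2) (ray (proj e 2 v)) Es;
      I \<subseteq> {1..m}; card I = 2; last Es = simplex_image e a 2 I\<rbrakk>
     \<Longrightarrow> optimal_simplex e m a v 2 I (length Es - 1)"
| next_stage:
    "\<lbrakk>optimal_simplex e m a v (k - 1) I N; 3 \<le> k; k \<le> CARD('n);
      start_edge e m a v k I (hd Es);
      successful_walk (section_polygon e m a v k) (ray (proj e k v)) Es;
      J \<subseteq> {1..m}; card J = k; simplex_image e a k J facet_of projY e m a k;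
      last Es = simplex_image e a k J \<inter> section_plane e v k\<rbrakk>
     \<Longrightarrow> optimal_simplex e m a v k J (N + (length Es - 1))"

text \<open>
  Complete executions with their output (\<open>None\<close> if no solution is reported) and total number of
  pivot steps.
\<close>
inductive shadow_vertex_run ::
    "(nat \<Rightarrow> real ^ 'n) \<Rightarrow> nat \<Rightarrow> (nat \<Rightarrow> real ^ 'n) \<Rightarrow> real ^ 'n \<Rightarrow> nat set option \<Rightarrow> nat \<Rightarrow> bool"
  for e m a v where
  solved:
    "optimal_simplex e m a v (CARD('n)) I N \<Longrightarrow> shadow_vertex_run e m a v (Some I) N"
| no_solution_first_stage:
    "unsuccessful_walk (projY e m a 2) (ray (proj e 2 v)) Es
     \<Longrightarrow> shadow_vertex_run e m a v None (length Es - 1)"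
| no_solution_later_stage:
    "\<lbrakk>optimal_simplex e m a v (k - 1) I N; 3 \<le> k; k \<le> CARD('n);
      start_edge e m a v k I (hd Es);
      unsuccessful_walk (section_polygon e m a v k) (ray (proj e k v)) Es\<rbrakk>
     \<Longrightarrow> shadow_vertex_run e m a v None (N + (length Es - 1))"

text \<open>
  The largest number of pivot steps over all resolutions of the free choices. As a function
  of \<open>(a, v)\<close> it is semialgebraic, hence Borel measurable. Inputs without any complete execution
  (where the value is \<open>0\<close>) are degenerate and form a null set once \<open>m \<ge> n\<close>.
\<close>
definition pivot_steps ::
    "(nat \<Rightarrow> real ^ 'n) \<Rightarrow> nat \<Rightarrow> (nat \<Rightarrow> real ^ 'n) \<Rightarrow> real ^ 'n \<Rightarrow> ennreal" where
  "pivot_steps e m a v = (SUP N \<in> {N. \<exists>res. shadow_vertex_run e m a v res N}. of_nat N)"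

text \<open>The joint law of the independent uniform points \<open>a 1, \<dots>, a m\<close> and \<open>v\<close>.\<close>
definition input_law :: "nat \<Rightarrow> ((nat \<Rightarrow> real ^ 'n) \<times> (real ^ 'n)) measure" where
  "input_law m = (\<Pi>\<^sub>M i\<in>{1..m}. uniform_sphere) \<Otimes>\<^sub>M uniform_sphere"

definition expected_pivot_steps :: "(nat \<Rightarrow> real ^ 'n) \<Rightarrow> nat \<Rightarrow> ennreal" where
  "expected_pivot_steps e m = (\<integral>\<^sup>+ (a, v). pivot_steps e m a v \<partial>input_law m)"

end

theory Submission
  imports Defs
begin

text \<open>
  Every edge of the stage-\<open>k\<close> polygon other than the polygon itself determines, by Caratheodory, an
  index set \<open>I\<close> of at most \<open>n + 1\<close> points whose projected hull meets it in relative interiors,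
  and \<open>I\<close> determines the edge. Suppose that every unit vector is within \<open>\<delta>\<close> of some \<open>a i\<close>. A normal
  \<open>u\<close> of a hyperplane supporting the projected polytope along the edge is then within \<open>\<delta>\<close> of all
  \<open>a i\<close> with \<open>i \<in> I\<close>, so these points lie within \<open>4 \<delta>\<close> of each other and within \<open>2 \<delta>\<close> of
  the section plane. The expected number of such index sets is at most of order
  \<open>m \<delta>\<^bsup>n-2\<^esup> (1 + m \<delta>\<^bsup>n-1\<^esup>)\<^bsup>n\<^esup>\<close>, for every fixed \<open>v\<close>. With \<open>\<delta>\<^bsup>n-1\<^esup> = K ln m / m\<close> this is
  \<open>m\<^bsup>1/(n-1)\<^esup>\<close> up to logarithms, and for large \<open>K\<close> the density assumption fails only with a
  probability that beats the trivial polynomial bound on the number of edges. Neither general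
  position nor the distribution of \<open>v\<close> plays a role.
\<close>

subsection \<open>Faces of plane sections of polytopes\<close>

text \<open>A point \<open>p\<close> in the relative interior of \<open>E\<close> is by Caratheodory
  a convex combination of few generators. Choosing one index for each of them turns points into
  indices even when \<open>c\<close> is not injective.\<close>

lemma face_of_section_carrier:
  fixes c :: "'b \<Rightarrow> 'a::euclidean_space"
  assumes E: "E face_of (convex hull (c ` J)) \<inter> L" "E \<noteq> {}" and "convex L"
  obtains I where "I \<subseteq> J" "finite I" "card I \<le> DIM('a) + 1"
    "rel_interior (convex hull (c ` I)) \<inter> rel_interior E \<noteq> {}"
proof -
  have "convex E"
    using E face_of_imp_convex convex_Int assms(3) by blast
  then obtain p where p: "p \<in> rel_interior E"
    using E(2) rel_interior_eq_empty by blast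
  then have "p \<in> convex hull (c ` J)"
    using E(1) face_of_imp_subset rel_interior_subset by blast
  then obtain S where S: "finite S" "S \<subseteq> c ` J" "card S \<le> DIM('a) + 1" "p \<in> convex hull S"
    unfolding caratheodory[of "c ` J"] mem_Collect_eq by (elim exE conjE)
  then obtain u where u: "\<forall>x\<in>S. 0 \<le> u x" "sum u S = 1" "(\<Sum>x\<in>S. u x *\<^sub>R x) = p"
    by (auto simp: convex_hull_finite)
  \<comment> \<open>Only strictly positive weights place \<open>p\<close> in the relative interior
    of the hull, so the generators of weight zero are dropped.\<close>
  define T where "T = {x \<in> S. 0 < u x}"
  have T: "finite T" "T \<subseteq> S" using S(1) by (auto simp: T_def)
  have z: "u x = 0" if "x \<in> S - T" for x
    using that u(1) by (force simp: T_def)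
  have "sum u T = 1" "(\<Sum>x\<in>T. u x *\<^sub>R x) = p"
    using u z S(1) T by (subst sum.mono_neutral_left[of S T]; simp)+
  then have pT: "p \<in> rel_interior (convex hull T)"
    using explicit_subset_rel_interior_convex_hull_minimal[OF T(1)] by (fastforce simp: T_def)
  from T S have "T \<subseteq> c ` J" by blast
  then obtain I where I: "I \<subseteq> J" "inj_on c I" "T = c ` I"
    unfolding subset_image_inj by blast
  have "card I = card T" using I by (simp add: card_image)
  also have "\<dots> \<le> card S" using T S by (simp add: card_mono)
  finally have "card I \<le> DIM('a) + 1" using S by simp
  moreover have "finite I" using I T finite_imageD by blast
  ultimately show thesis using that I p pT by blast
qed

text \<open>A face that contains a relative interior point of a convex subset contains the whole
  subset. Hence \<open>K \<inter> L\<close> lies in both faces, so each face contains a relative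
  interior point of the other.\<close>

lemma face_of_section_carrier_unique:
  fixes P :: "'a::euclidean_space set"
  assumes E: "E face_of P \<inter> L" and E': "E' face_of P \<inter> L" and "affine L"
    and K: "convex K" "K \<subseteq> P"
    and "rel_interior K \<inter> rel_interior E \<noteq> {}" "rel_interior K \<inter> rel_interior E' \<noteq> {}"
  shows "E = E'"
proof -
  obtain p p' where p: "p \<in> rel_interior K" "p \<in> rel_interior E"
    and p': "p' \<in> rel_interior K" "p' \<in> rel_interior E'"
    using assms by blast
  have pE: "p \<in> E" "p' \<in> E'" using p p' rel_interior_subset by blast+
  then have L: "p \<in> L" "p' \<in> L" using E E' face_of_imp_subset by blast+
  \<comment> \<open>Cutting with an affine set commutes with taking relative interiors, because
    \<open>L\<close> meets the relative interior of \<open>K\<close> in \<open>p\<close>.\<close>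
  have *: "rel_interior (K \<inter> L) = rel_interior K \<inter> L"
    using convex_affine_rel_interior_Int[OF K(1) \<open>affine L\<close>] p L by blast
  have "K \<inter> L \<subseteq> E" "K \<inter> L \<subseteq> E'"
    using subset_of_face_of[OF E, of "K \<inter> L"] subset_of_face_of[OF E', of "K \<inter> L"]
      K p p' L pE * by blast+
  then have "p \<in> E'" using p L rel_interior_subset by blast
  have "E \<subseteq> E'"
    using subset_of_face_of[OF E', of E] \<open>p \<in> E'\<close> p E face_of_imp_subset by blast
  moreover have "E' \<subseteq> E"
    using subset_of_face_of[OF E, of E'] \<open>K \<inter> L \<subseteq> E\<close> p' L E' face_of_imp_subset rel_interior_subset
    by blast
  ultimately show ?thesis by blast
qed

text \<open>Choosing a carrier for each face is injective by uniqueness, so faces are counted by any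
  finite family that is known to contain all their carriers.\<close>

lemma card_faces_of_section_le:
  fixes c :: "'b \<Rightarrow> 'a::euclidean_space"
  assumes "affine L" "finite \<I>"
    and fam: "\<And>E. E \<in> \<F> \<Longrightarrow> E face_of (convex hull (c ` J)) \<inter> L \<and> E \<noteq> {}"
    and carrier: "\<And>E I. E \<in> \<F> \<Longrightarrow> I \<subseteq> J \<Longrightarrow> finite I \<Longrightarrow> card I \<le> DIM('a) + 1 \<Longrightarrow>
      rel_interior (convex hull (c ` I)) \<inter> rel_interior E \<noteq> {} \<Longrightarrow> I \<in> \<I>"
  shows "finite \<F>" "card \<F> \<le> card \<I>"
proof -
  have "\<exists>I. I \<subseteq> J \<and> I \<in> \<I> \<and> rel_interior (convex hull (c ` I)) \<inter> rel_interior E \<noteq> {}"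
    if "E \<in> \<F>" for E
    using face_of_section_carrier[of E c J L] fam[OF that] affine_imp_convex[OF \<open>affine L\<close>] carrier[OF that]
    by metis
  then obtain g where g: "\<And>E. E \<in> \<F> \<Longrightarrow> g E \<subseteq> J \<and> g E \<in> \<I> \<and>
      rel_interior (convex hull (c ` g E)) \<inter> rel_interior E \<noteq> {}"
    by metis
  have inj: "inj_on g \<F>"
  proof (rule inj_onI)
    fix E E' assume E: "E \<in> \<F>" "E' \<in> \<F>" "g E = g E'"
    show "E = E'"
      by (rule face_of_section_carrier_unique[of E "convex hull (c ` J)" L E' "convex hull (c ` g E)"])
        (use E g[of E] g[of E'] fam \<open>affine L\<close> in \<open>auto intro!: hull_mono\<close>)
  qed
  have "g ` \<F> \<subseteq> \<I>" using g by blast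
  then show "finite \<F>" "card \<F> \<le> card \<I>"
    using inj \<open>finite \<I>\<close> by (auto intro: inj_on_finite card_inj_on_le)
qed

text \<open>
  A supporting hyperplane of the projection pulls back along the self-adjoint \<open>f\<close> to one of the original
  polytope with the same normal \<open>u\<close>, and density forces it to within \<open>\<delta>\<^sup>2 / 2\<close> of height 1.
\<close>
lemma proper_face_of_section_near:
  fixes b :: "'b \<Rightarrow> 'a::euclidean_space"
  assumes f: "linear f" "\<And>x y. f x \<bullet> y = x \<bullet> f y" "\<And>x. f (f x) = f x"
    and b: "\<And>i. i \<in> J \<Longrightarrow> b i = 0 \<or> norm (b i) = 1"
    and dense: "\<And>u. norm u = 1 \<Longrightarrow> \<exists>j\<in>J. norm (b j) = 1 \<and> dist (b j) u \<le> \<delta>"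
    and \<delta>: "0 \<le> \<delta>" "\<delta> < 1" and "affine L"
    and E: "E face_of (convex hull ((\<lambda>i. f (b i)) ` J)) \<inter> L"
      "E \<noteq> (convex hull ((\<lambda>i. f (b i)) ` J)) \<inter> L"
    and I: "I \<subseteq> J" and p: "p \<in> rel_interior (convex hull ((\<lambda>i. f (b i)) ` I))" "p \<in> rel_interior E"
  shows "p \<in> L" "norm p \<le> 1" "\<forall>i\<in>I. norm (b i) = 1 \<and> dist (b i) p \<le> 2 * \<delta>"
proof -
  let ?P = "convex hull ((\<lambda>i. f (b i)) ` J)"
  let ?K = "convex hull ((\<lambda>i. f (b i)) ` I)"
  have "p \<in> E" using p rel_interior_subset by blast
  then have pP: "p \<in> ?P" and "p \<in> L" using E face_of_imp_subset by blast+
  show "p \<in> L" by fact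
  have KP: "?K \<subseteq> ?P" using I by (intro hull_mono) auto
  \<comment> \<open>Otherwise \<open>p\<close> would be a relative interior point of the section,
    and the face \<open>E\<close> would be the whole section.\<close>
  have np: "p \<notin> rel_interior ?P"
  proof
    assume "p \<in> rel_interior ?P"
    then have "p \<in> rel_interior (?P \<inter> L)"
      using convex_affine_rel_interior_Int[of ?P L] \<open>affine L\<close> \<open>p \<in> L\<close> by blast
    then have "?P \<inter> L \<subseteq> E"
      using subset_of_face_of[OF E(1), of "?P \<inter> L"] \<open>p \<in> E\<close> by blast
    then show False using E face_of_imp_subset by blast
  qed
  obtain w where w: "\<And>y. y \<in> ?P \<Longrightarrow> w \<bullet> p \<le> w \<bullet> y" "\<And>y. y \<in> rel_interior ?P \<Longrightarrow> w \<bullet> p < w \<bullet> y"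
    using supporting_hyperplane_rel_boundary[of ?P p] np pP by (metis convex_convex_hull)
  have fP: "f y = y" if "y \<in> ?P" for y
  proof -
    have "?P = f ` (convex hull (b ` J))"
      using convex_hull_linear_image[OF f(1), of "b ` J"] by (simp add: image_image)
    then show ?thesis using that f(3) by auto
  qed
  \<comment> \<open>A functional with \<open>f w = 0\<close> vanishes on the polytope, since
    \<open>f\<close> is self-adjoint and fixes its points; this contradicts the strict inequality on
    the relative interior.\<close>
  have "f w \<noteq> 0"
  proof
    assume "f w = 0"
    then have *: "w \<bullet> y = 0" if "y \<in> ?P" for y
      using fP[OF that] f(2)[of w y] by simp
    have "rel_interior ?P \<noteq> {}" using pP by (auto simp: rel_interior_eq_empty)
    then obtain y where "y \<in> rel_interior ?P" by blast
    then show False using w(2)[of y] *[OF pP] * rel_interior_subset by fastforce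
  qed
  \<comment> \<open>The sign makes \<open>p\<close> a maximiser of \<open>u\<close>. Applying
    \<open>f\<close> puts \<open>u\<close> into the range of \<open>f\<close>, so that
    \<open>b i\<close> and \<open>f (b i)\<close> have the same height.\<close>
  define u where "u = (- 1 / norm (f w)) *\<^sub>R f w"
  have u: "norm u = 1" "f u = u" 
    using \<open>f w \<noteq> 0\<close> f(3) linear_scale[OF f(1), of "- 1 / norm (f w)" "f w"] by (auto simp: u_def)
  have uw: "u \<bullet> y = (- 1 / norm (f w)) * (w \<bullet> y)" if "y \<in> ?P" for y
    using fP[OF that] f(2)[of w y] by (simp add: u_def)
  have max: "u \<bullet> y \<le> u \<bullet> p" if "y \<in> ?P" for y
    using w(1)[OF that] \<open>f w \<noteq> 0\<close> by (simp add: uw that pP divide_right_mono)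
  have "?P \<inter> {x. u \<bullet> x = u \<bullet> p} face_of ?P"
    by (rule face_of_Int_supporting_hyperplane_le) (use max in auto)
  then have Ku: "?K \<subseteq> {x. u \<bullet> x = u \<bullet> p}"
    using subset_of_face_of[of _ ?P ?K] KP p(1) pP by blast
  have ub: "u \<bullet> f (b i) = u \<bullet> b i" for i
    using f(2)[of u "b i"] u by simp
  \<comment> \<open>On the unit sphere the height in direction \<open>u\<close> determines the
    distance to \<open>u\<close>. Unit generators on the supporting hyperplane are therefore at
    least as close to \<open>u\<close> as the point \<open>b j\<close> supplied by density.\<close>
  have sq: "(dist x u)\<^sup>2 = 2 - 2 * (u \<bullet> x)" if "norm x = 1" for x
    using that u by (simp add: dist_norm power2_norm_eq_inner inner_diff inner_commute norm_eq_1)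
  obtain j where j: "j \<in> J" "norm (b j) = 1" "dist (b j) u \<le> \<delta>"
    using dense u by blast
  have "(dist (b j) u)\<^sup>2 \<le> \<delta>\<^sup>2" using j by (intro power_mono) auto
  moreover have "u \<bullet> b j \<le> u \<bullet> p"
    using max[of "f (b j)"] j ub by (simp add: hull_inc)
  ultimately have h: "2 - \<delta>\<^sup>2 \<le> 2 * (u \<bullet> p)" using sq[OF j(2)] by linarith
  have "\<delta>\<^sup>2 \<le> 1" using \<delta> by (simp add: power_le_one)
  then have hpos: "u \<bullet> p > 0" using h by linarith
  have near: "norm (b i) = 1 \<and> dist (b i) u \<le> \<delta>" if "i \<in> I" for i
  proof -
    have "f (b i) \<in> ?K" using that by (simp add: hull_inc)
    then have ui: "u \<bullet> b i = u \<bullet> p" using Ku ub by auto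
    \<comment> \<open>Positive height excludes \<open>b i = 0\<close>, the only alternative to norm
      1.\<close>
    then have n: "norm (b i) = 1" using b[of i] that I hpos by (metis inner_zero_right less_irrefl subsetD)
    have "(dist (b i) u)\<^sup>2 \<le> \<delta>\<^sup>2" using sq[OF n] ui h by linarith
    then show ?thesis using n \<delta> power2_le_imp_le by blast
  qed
  have fn: "norm (f x) \<le> norm x" for x
  proof (cases "f x = 0")
    case False
    have "norm (f x) * norm (f x) = x \<bullet> f x"
      using f(2)[of x "f x"] f(3) by (metis power2_eq_square power2_norm_eq_inner)
    also have "\<dots> \<le> norm x * norm (f x)" by (rule norm_cauchy_schwarz)
    finally show ?thesis using False by simp
  qed auto
  \<comment> \<open>As \<open>f\<close> fixes \<open>u\<close> and does not increase norms, the
    projected points, their hull and thus \<open>p\<close> stay within \<delta> of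
    \<open>u\<close>.\<close>
  have "?K \<subseteq> cball 0 1 \<inter> cball u \<delta>"
  proof (rule hull_minimal)
    show "(\<lambda>i. f (b i)) ` I \<subseteq> cball 0 1 \<inter> cball u \<delta>"
    proof clarify
      fix i assume i: "i \<in> I"
      have "norm (f (b i)) \<le> 1" using fn[of "b i"] near[OF i] by simp
      moreover have "dist u (f (b i)) = norm (f (u - b i))"
        using u f(1) by (simp add: dist_norm linear_diff)
      then have "dist u (f (b i)) \<le> \<delta>" using fn[of "u - b i"] near[OF i]
        by (simp add: dist_norm norm_minus_commute)
      ultimately show "f (b i) \<in> cball 0 1 \<inter> cball u \<delta>" by simp
    qed
  qed (simp add: convex_Int)
  then have pu: "p \<in> cball 0 1" "p \<in> cball u \<delta>"
    using p(1) rel_interior_subset by blast+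
  then show "norm p \<le> 1" by simp
  show "\<forall>i\<in>I. norm (b i) = 1 \<and> dist (b i) p \<le> 2 * \<delta>"
  proof clarify
    fix i assume "i \<in> I"
    then show "norm (b i) = 1 \<and> dist (b i) p \<le> 2 * \<delta>"
      using near[of i] pu(2) dist_triangle[of "b i" p u] by simp
  qed
qed

subsection \<open>Edges visited by the algorithm\<close>

lemma linear_proj: "linear (proj e k)"
  by (rule linearI) (simp_all add: proj_def inner_add_left scaleR_add_left sum.distrib scaleR_sum_right)

lemma proj_self_adjoint: "proj e k x \<bullet> y = x \<bullet> proj e k y"
  by (simp add: proj_def inner_sum_left inner_sum_right inner_commute mult.commute)

text \<open>Idempotence rests on the orthonormality of \<open>e 1, ..., e k\<close>, which the
  enumeration guarantees for indices up to \<open>CARD('n)\<close>.\<close>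

lemma proj_idem:
  fixes e :: "nat \<Rightarrow> real ^ 'n"
  assumes e: "bij_betw e {1..CARD('n)} Basis" and k: "k \<le> CARD('n)"
  shows "proj e k (proj e k x) = proj e k x"
proof -
  have *: "e i \<bullet> e j = (if i = j then 1 else 0)" if "i \<in> {1..k}" "j \<in> {1..k}" for i j
  proof -
    have ij: "i \<in> {1..CARD('n)}" "j \<in> {1..CARD('n)}" using that k by auto
    then have "e i \<in> Basis" "e j \<in> Basis" using bij_betwE[OF e] by auto
    moreover have "e i = e j \<longleftrightarrow> i = j" by (rule inj_on_eq_iff[OF bij_betw_imp_inj_on[OF e] ij])
    ultimately show ?thesis by (simp add: inner_Basis)
  qed
  have "proj e k x \<bullet> e j = x \<bullet> e j" if j: "j \<in> {1..k}" for j
  proof -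
    have "proj e k x \<bullet> e j = (\<Sum>i=1..k. (x \<bullet> e i) * (e i \<bullet> e j))"
      by (simp add: proj_def inner_sum_left)
    also have "\<dots> = (\<Sum>i=1..k. if i = j then x \<bullet> e i else 0)"
      using j by (intro sum.cong) (auto simp: *)
    also have "\<dots> = x \<bullet> e j" using j by (simp add: sum.delta)
    finally show ?thesis .
  qed
  then show ?thesis by (subst (1 3) proj_def) (auto intro: sum.cong)
qed

text \<open>Index 0 stands for the origin, so that all generators of \<open>Y\<close> form a single
  indexed family.\<close>

definition lifted_point :: "(nat \<Rightarrow> real ^ 'n) \<Rightarrow> nat \<Rightarrow> real ^ 'n" where
  "lifted_point a i = (if i = 0 then 0 else a i)"

lemma projY_eq_hull: "projY e m a k = convex hull ((\<lambda>i. proj e k (lifted_point a i)) ` {0..m})"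
proof -
  have "{0..m} = insert 0 {1..m}" by auto
  then have "lifted_point a ` {0..m} = insert 0 (a ` {1..m})"
    by (auto simp: lifted_point_def image_iff)
  moreover have "(\<lambda>i. proj e k (lifted_point a i)) ` {0..m} = proj e k ` lifted_point a ` {0..m}"
    by (simp add: image_image)
  ultimately show ?thesis
    unfolding projY_def Y_def using convex_hull_linear_image[OF linear_proj] by metis
qed

text \<open>In dimension 2 the polygon is not cut; a plane containing it makes all stages alike.\<close>
definition stage_plane :: "(nat \<Rightarrow> real ^ 'n) \<Rightarrow> real ^ 'n \<Rightarrow> nat \<Rightarrow> (real ^ 'n) set" where
  "stage_plane e v k = (if k = 2 then span {e 1, e 2} else section_plane e v k)"

definition stage_polygon ::
    "(nat \<Rightarrow> real ^ 'n) \<Rightarrow> nat \<Rightarrow> (nat \<Rightarrow> real ^ 'n) \<Rightarrow> real ^ 'n \<Rightarrow> nat \<Rightarrow> (real ^ 'n) set" where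
  "stage_polygon e m a v k = projY e m a k \<inter> stage_plane e v k"

lemma subspace_stage_plane: "subspace (stage_plane e v k)"
  by (simp add: stage_plane_def section_plane_def)

lemma dim_stage_plane:
  fixes v :: "real ^ 'n"
  shows "dim (stage_plane e v k) \<le> 2"
proof -
  have "dim (span {x, y}) \<le> 2" for x y :: "real^'n"
    using dim_le_card'[of "{x, y}"] card_insert_le_m1[of 2 "{y}" x] by simp
  then show ?thesis by (simp add: stage_plane_def section_plane_def)
qed

lemma stage_polygon_2: "stage_polygon e m a v 2 = projY e m a 2"
proof -
  have "proj e 2 x = (x \<bullet> e 1) *\<^sub>R e 1 + (x \<bullet> e 2) *\<^sub>R e 2" for x
    by (simp add: proj_def numeral_2_eq_2)
  then have "proj e 2 x \<in> span {e 1, e 2}" for x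
    by (simp add: span_add span_base span_scale)
  then show ?thesis by (auto simp: stage_polygon_def stage_plane_def projY_def)
qed

lemma stage_polygon_ge_3: "3 \<le> k \<Longrightarrow> stage_polygon e m a v k = section_polygon e m a v k"
  by (simp add: stage_polygon_def stage_plane_def section_polygon_def)

section \<open>Proper edges and their carriers\<close>

text \<open>A polygon that degenerates to a segment is an edge of itself; it is set aside because
  supporting hyperplanes are available for proper faces only.\<close>

definition proper_edges ::
    "(nat \<Rightarrow> real ^ 'n) \<Rightarrow> nat \<Rightarrow> (nat \<Rightarrow> real ^ 'n) \<Rightarrow> real ^ 'n \<Rightarrow> nat \<Rightarrow> (real ^ 'n) set set" where
  "proper_edges e m a v k =
     {E. E edge_of stage_polygon e m a v k \<and> E \<noteq> stage_polygon e m a v k}"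

lemma proper_edgesD:
  assumes "E \<in> proper_edges e m a v k"
  shows "E face_of (convex hull ((\<lambda>i. proj e k (lifted_point a i)) ` {0..m})) \<inter> stage_plane e v k"
    "E \<noteq> (convex hull ((\<lambda>i. proj e k (lifted_point a i)) ` {0..m})) \<inter> stage_plane e v k" "E \<noteq> {}"
  using assms by (auto simp: proper_edges_def stage_polygon_def edge_of_def projY_eq_hull)

definition index_sets :: "nat set \<Rightarrow> nat \<Rightarrow> nat set set" where
  "index_sets J q = {I. I \<subseteq> J \<and> card I \<le> q}"

lemma finite_index_sets: "finite J \<Longrightarrow> finite (index_sets J q)"
  by (auto simp: index_sets_def)

lemma proper_edges_card_le:
  fixes a :: "nat \<Rightarrow> real ^ 'n"
  shows "finite (proper_edges e m a v k)"
    "card (proper_edges e m a v k) \<le> card (index_sets {0..m} (CARD('n) + 1))"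
  using card_faces_of_section_le[OF subspace_imp_affine[OF subspace_stage_plane[of e v k]]
      finite_index_sets[of "{0..m}" "CARD('n) + 1"],
      of "proper_edges e m a v k" "\<lambda>i. proj e k (lifted_point a i)" "{0..m}"]
    proper_edgesD[of _ e m a v k]
  by (auto simp: index_sets_def)

text \<open>The least index serves as centre. Once its point is fixed, the conditions on the other
  indices concern independent points. Intersecting with the unit ball leaves a compact piece of
  \<open>L\<close>, which a finite net covers.\<close>

definition clustered :: "(real ^ 'n) set \<Rightarrow> real \<Rightarrow> (nat \<Rightarrow> real ^ 'n) \<Rightarrow> nat set \<Rightarrow> bool" where
  "clustered L \<delta> a I \<longleftrightarrow> infdist (a (Min I)) (L \<inter> cball 0 1) \<le> 2 * \<delta> \<and>
     (\<forall>j\<in>I - {Min I}. dist (a j) (a (Min I)) \<le> 4 * \<delta>)"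

definition cluster_sets :: "(real ^ 'n) set \<Rightarrow> real \<Rightarrow> nat \<Rightarrow> (nat \<Rightarrow> real ^ 'n) \<Rightarrow> nat set set" where
  "cluster_sets L \<delta> m a = {I \<in> index_sets {1..m} (CARD('n) + 1). I \<noteq> {} \<and> clustered L \<delta> a I}"

text \<open>The common point \<open>p\<close> of carrier and edge lies in the stage plane and in the
  unit ball, within \<open>2 * \<delta>\<close> of every point of the carrier. It therefore
  witnesses both conditions of \<open>clustered\<close>.\<close>

lemma proper_edges_card_le_cluster_sets:
  fixes a :: "nat \<Rightarrow> real ^ 'n"
  assumes e: "bij_betw e {1..CARD('n)} Basis" and k: "k \<le> CARD('n)"
    and a: "\<And>i. i \<in> {1..m} \<Longrightarrow> norm (a i) = 1"
    and dense: "\<And>u. norm u = 1 \<Longrightarrow> \<exists>j\<in>{1..m}. dist (a j) u \<le> \<delta>"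
    and \<delta>: "0 \<le> \<delta>" "\<delta> < 1"
  shows "card (proper_edges e m a v k) \<le> card (cluster_sets (stage_plane e v k) \<delta> m a)"
proof (rule card_faces_of_section_le(2))
  let ?L = "stage_plane e v k"
  show aff: "affine ?L"
    by (rule subspace_imp_affine[OF subspace_stage_plane])
  show "finite (cluster_sets ?L \<delta> m a)"
    using finite_index_sets[of "{1..m}" "CARD('n) + 1"] by (simp add: cluster_sets_def)
  show "E face_of (convex hull ((\<lambda>i. proj e k (lifted_point a i)) ` {0..m})) \<inter> ?L \<and> E \<noteq> {}"
    if "E \<in> proper_edges e m a v k" for E
    using proper_edgesD[OF that] by blast
  fix E I
  assume E: "E \<in> proper_edges e m a v k" and I: "I \<subseteq> {0..m}" "finite I" "card I \<le> DIM(real^'n) + 1"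
    and "rel_interior (convex hull ((\<lambda>i. proj e k (lifted_point a i)) ` I)) \<inter> rel_interior E \<noteq> {}"
  then obtain p where p: "p \<in> rel_interior (convex hull ((\<lambda>i. proj e k (lifted_point a i)) ` I))"
    "p \<in> rel_interior E" by blast
  have norm_lp: "lifted_point a i = 0 \<or> norm (lifted_point a i) = 1" if "i \<in> {0..m}" for i
    using that a[of i] by (auto simp: lifted_point_def)
  have dense_lp: "\<exists>j\<in>{0..m}. norm (lifted_point a j) = 1 \<and> dist (lifted_point a j) u \<le> \<delta>"
    if u: "norm u = 1" for u
  proof -
    obtain j where "j \<in> {1..m}" "dist (a j) u \<le> \<delta>" using dense[OF u] by blast
    then show ?thesis by (intro bexI[of _ j]) (auto simp: lifted_point_def a)
  qed
  note * = proper_face_of_section_near[OF linear_proj proj_self_adjoint proj_idem[OF e k]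
      norm_lp dense_lp \<delta> aff proper_edgesD(1,2)[OF E] I(1) p]
  \<comment> \<open>Index 0 denotes the origin, whereas all carrier points have norm 1.\<close>
  have I0: "0 \<notin> I" using *(3) by (auto simp: lifted_point_def)
  have "{0..m} - {0} = {1..m}" by auto
  then have I1: "I \<subseteq> {1..m}" using I(1) I0 by blast
  have near: "dist (a i) p \<le> 2 * \<delta>" if "i \<in> I" for i
    using *(3) that I0 by (auto simp: lifted_point_def split: if_splits)
  have "I \<noteq> {}" using p(1) by auto
  then have mI: "Min I \<in> I" using I(2) by simp
  have "infdist (a (Min I)) (?L \<inter> cball 0 1) \<le> 2 * \<delta>"
    using infdist_le2[of p "?L \<inter> cball 0 1" "a (Min I)"] near[OF mI] *(1,2) by simp
  moreover have "dist (a j) (a (Min I)) \<le> 4 * \<delta>" if "j \<in> I" for j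
    using dist_triangle2[of "a j" "a (Min I)" p] near[OF mI] near[OF that] by simp
  ultimately show "I \<in> cluster_sets ?L \<delta> m a"
    using I1 I(3) \<open>I \<noteq> {}\<close> by (simp add: cluster_sets_def index_sets_def clustered_def)
qed

section \<open>Steps of walks and runs charged to proper edges\<close>

text \<open>The edges of a walk are distinct and number one more than its steps. That surplus pays
  for the polygon itself, which may occur as an edge.\<close>

lemma walk_length_le:
  assumes "polygon_walk (stage_polygon e m a v k) R Es"
  shows "length Es - 1 \<le> card (proper_edges e m a v k)"
proof -
  have "set Es \<subseteq> insert (stage_polygon e m a v k) (proper_edges e m a v k)"
    using assms by (auto simp: polygon_walk_def proper_edges_def)
  then have "card (set Es) \<le> card (insert (stage_polygon e m a v k) (proper_edges e m a v k))"
    by (intro card_mono) (simp_all add: proper_edges_card_le)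
  also have "\<dots> \<le> Suc (card (proper_edges e m a v k))"
    by (rule card_insert_le_m1) auto
  finally show ?thesis
    using assms distinct_card[of Es] by (simp add: polygon_walk_def)
qed

lemma optimal_simplex_steps_le:
  fixes a :: "nat \<Rightarrow> real ^ 'n"
  assumes "optimal_simplex e m a v k I N"
  shows "2 \<le> k \<and> N \<le> (\<Sum>j=2..k. card (proper_edges e m a v j))"
  using assms
proof induction
  case (first_stage Es I)
  then show ?case
    using walk_length_le[of e m a v 2 "ray (proj e 2 v)" Es] by (simp add: stage_polygon_2 successful_walk_def)
next
  case (next_stage k I N Es J)
  then have "length Es - 1 \<le> card (proper_edges e m a v k)"
    using walk_length_le[of e m a v k "ray (proj e k v)" Es] by (simp add: stage_polygon_ge_3 successful_walk_def)
  moreover have "{2..k} = insert k {2..k - 1}" using next_stage by auto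
  then have "(\<Sum>j=2..k. card (proper_edges e m a v j)) =
      card (proper_edges e m a v k) + (\<Sum>j=2..k - 1. card (proper_edges e m a v j))"
    using next_stage by simp
  ultimately show ?case using next_stage by linarith
qed

text \<open>Runs that report no solution at an early stage are charged for the later stages as well,
  which gives one bound for all outcomes.\<close>

lemma shadow_vertex_run_steps_le:
  fixes a :: "nat \<Rightarrow> real ^ 'n"
  assumes "shadow_vertex_run e m a v res N" and n: "2 \<le> CARD('n)"
  shows "N \<le> (\<Sum>j=2..CARD('n). card (proper_edges e m a v j))"
  using assms(1)
proof cases
  case (solved I)
  then show ?thesis using optimal_simplex_steps_le by blast
next
  case (no_solution_first_stage Es)
  then have "N \<le> card (proper_edges e m a v 2)"
    using walk_length_le[of e m a v 2 "ray (proj e 2 v)" Es] by (simp add: stage_polygon_2 unsuccessful_walk_def)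
  also have "\<dots> \<le> (\<Sum>j=2..CARD('n). card (proper_edges e m a v j))"
    by (rule member_le_sum) (use n in auto)
  finally show ?thesis .
next
  case (no_solution_later_stage k I N' Es)
  then have "length Es - 1 \<le> card (proper_edges e m a v k)"
    using walk_length_le[of e m a v k "ray (proj e k v)" Es] by (simp add: stage_polygon_ge_3 unsuccessful_walk_def)
  moreover have "N' \<le> (\<Sum>j=2..k - 1. card (proper_edges e m a v j))"
    using optimal_simplex_steps_le no_solution_later_stage by blast
  moreover have "{2..k} = insert k {2..k - 1}" using no_solution_later_stage by auto
  then have "(\<Sum>j=2..k. card (proper_edges e m a v j)) =
      card (proper_edges e m a v k) + (\<Sum>j=2..k - 1. card (proper_edges e m a v j))"
    using no_solution_later_stage by simp
  moreover have "(\<Sum>j=2..k. card (proper_edges e m a v j)) \<le> (\<Sum>j=2..CARD('n). card (proper_edges e m a v j))"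
    using no_solution_later_stage by (intro sum_mono2) auto
  ultimately show ?thesis using no_solution_later_stage by linarith
qed

lemma pivot_steps_le:
  fixes a :: "nat \<Rightarrow> real ^ 'n"
  assumes "2 \<le> CARD('n)"
  shows "pivot_steps e m a v \<le> (\<Sum>j=2..CARD('n). of_nat (card (proper_edges e m a v j)))"
  unfolding pivot_steps_def
proof (rule SUP_least)
  fix N assume "N \<in> {N. \<exists>res. shadow_vertex_run e m a v res N}"
  then have "N \<le> (\<Sum>j=2..CARD('n). card (proper_edges e m a v j))"
    using shadow_vertex_run_steps_le assms by blast
  then show "of_nat N \<le> (\<Sum>j=2..CARD('n). (of_nat (card (proper_edges e m a v j)) :: ennreal))"
    by (metis of_nat_mono of_nat_sum)
qed

subsection \<open>Cone measure of caps and tubes\<close>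

text \<open>Coordinates in an orthonormal basis of \<open>L\<close> are rounded down to multiples of
  \<open>1 / M\<close>. Each coordinate takes \<open>2 * M + 1\<close> values and contributes at
  most \<open>1 / M\<close> to the error.\<close>

lemma subspace_net:
  fixes L :: "'a::euclidean_space set"
  assumes L: "subspace L" and M: "M > 0"
  obtains G where "finite G" "card G \<le> (2 * M + 1) ^ dim L"
    "\<And>x. x \<in> L \<Longrightarrow> norm x \<le> 1 \<Longrightarrow> \<exists>g\<in>G. dist x g \<le> real (dim L) / real M"
proof -
  obtain B where B: "B \<subseteq> L" "pairwise orthogonal B" "\<And>x. x \<in> B \<Longrightarrow> norm x = 1"
    "independent B" "card B = dim L" "span B = L"
    using orthonormal_basis_subspace[OF L] by metis
  have fB: "finite B" using B(4) by (rule independent_imp_finite)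
  define F where "F = B \<rightarrow>\<^sub>E {- int M..int M}"
  define h where "h = (\<lambda>f. \<Sum>b\<in>B. (real_of_int (f b) / real M) *\<^sub>R b)"
  have "finite F" using fB by (auto simp: F_def intro: finite_PiE)
  have "card F = (2 * M + 1) ^ dim L"
    using fB B(5) by (simp add: F_def card_PiE nat_add_distrib nat_mult_distrib)
  then have "card (h ` F) \<le> (2 * M + 1) ^ dim L"
    using card_image_le[OF \<open>finite F\<close>, of h] by simp
  moreover have "\<exists>g\<in>h ` F. dist x g \<le> real (dim L) / real M" if x: "x \<in> L" "norm x \<le> 1" for x
  proof -
    define f where "f = (\<lambda>b\<in>B. \<lfloor>real M * (x \<bullet> b)\<rfloor>)"
    have xb: "\<bar>x \<bullet> b\<bar> \<le> 1" if "b \<in> B" for b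
      using Cauchy_Schwarz_ineq2[of x b] B(3)[OF that] x(2) by simp
    have "f \<in> F"
    proof -
      have "f b \<in> {- int M..int M}" if "b \<in> B" for b
      proof -
        have "\<bar>real M * (x \<bullet> b)\<bar> \<le> real M"
          using mult_left_mono[OF xb[OF that], of "real M"] by (simp add: abs_mult)
        then have "- real M \<le> real M * (x \<bullet> b)" "real M * (x \<bullet> b) < real M + 1" by linarith+
        then show ?thesis using that by (auto simp: f_def le_floor_iff floor_le_iff)
      qed
      then show ?thesis by (auto simp: F_def f_def)
    qed
    have "x = (\<Sum>b\<in>B. (x \<bullet> b) *\<^sub>R b)"
      using orthonormal_basis_expand[OF B(2,3) _ fB, of x] B(6) x by simp
    then have "dist x (h f) = norm (\<Sum>b\<in>B. (x \<bullet> b - real_of_int (f b) / real M) *\<^sub>R b)"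
      by (simp add: h_def dist_norm scaleR_diff_left sum_subtractf)
    also have "\<dots> \<le> (\<Sum>b\<in>B. 1 / real M)"
    proof (rule sum_norm_le)
      fix b assume b: "b \<in> B"
      have "\<bar>real M * (x \<bullet> b) - real_of_int (f b)\<bar> \<le> 1"
        using b by (simp add: f_def) linarith
      moreover have "x \<bullet> b - real_of_int (f b) / real M = (real M * (x \<bullet> b) - real_of_int (f b)) / real M"
        using M by (simp add: field_simps)
      ultimately show "norm ((x \<bullet> b - real_of_int (f b) / real M) *\<^sub>R b) \<le> 1 / real M"
        using M B(3)[OF b] by (simp add: divide_right_mono)
    qed
    also have "\<dots> = real (dim L) / real M" using B(5) by simp
    finally show ?thesis using \<open>f \<in> F\<close> by blast
  qed
  ultimately show thesis using that[of "h ` F"] \<open>finite F\<close> by blast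
qed

section \<open>Cone measure and Lebesgue volume\<close>

lemma measurable_normalize [measurable]:
  "(\<lambda>x::'a::euclidean_space. x /\<^sub>R norm x) \<in> borel_measurable borel"
  by measurable

lemma space_uniform_sphere [simp]: "space uniform_sphere = UNIV"
  and sets_uniform_sphere [simp, measurable_cong]: "sets uniform_sphere = sets borel"
  by (simp_all add: uniform_sphere_def)

lemma ball_measure_nontrivial:
  "emeasure lborel (ball (0::'a::euclidean_space) 1) \<noteq> 0"
  "emeasure lborel (ball (0::'a::euclidean_space) 1) \<noteq> \<infinity>"
  by (auto simp: emeasure_ball unit_ball_vol_pos less_imp_neq[symmetric])

interpretation uniform_sphere: prob_space uniform_sphere
  unfolding uniform_sphere_def
  by (intro prob_space.prob_space_distr prob_space_uniform_measure ball_measure_nontrivial) simp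

text \<open>The set whose volume is the cone measure of \<open>A\<close> up to a constant factor.
  Normalisation fixes the centre 0, so the centre belongs to it exactly when
  \<open>0 \<in> A\<close>.\<close>

abbreviation ucone :: "(real ^ 'n) set \<Rightarrow> (real ^ 'n) set" where
  "ucone A \<equiv> {x \<in> ball 0 1. x /\<^sub>R norm x \<in> A}"

lemma ucone_eq: "ucone A = ball 0 1 \<inter> (\<lambda>x. x /\<^sub>R norm x) -` A"
  by auto

lemma sets_ucone [measurable]: "A \<in> sets borel \<Longrightarrow> ucone A \<in> sets borel"
  unfolding ucone_eq using measurable_sets[OF measurable_normalize] by fastforce

lemma fmeasurable_cball: "cball x r \<in> fmeasurable lborel"
  by (rule fmeasurableI) (use emeasure_bounded_finite[OF bounded_cball[of x r]] in auto)

lemma fmeasurable_ucone: "A \<in> sets borel \<Longrightarrow> ucone A \<in> fmeasurable lborel"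
  by (rule fmeasurableI2[OF fmeasurable_cball[of 0 1]]) auto

lemma measure_uniform_sphere:
  fixes A :: "(real ^ 'n) set"
  assumes [measurable]: "A \<in> sets borel"
  shows "unit_ball_vol CARD('n) * measure uniform_sphere A = measure lborel (ucone A)"
proof -
  have "(\<lambda>x::real^'n. x /\<^sub>R norm x) -` A \<in> sets lborel"
    using measurable_sets[OF measurable_normalize assms] by simp
  from measure_uniform_measure[OF ball_measure_nontrivial this]
  have "measure uniform_sphere A = measure lborel (ucone A) / measure lborel (ball (0::real^'n) 1)"
    unfolding uniform_sphere_def ucone_eq
    by (subst measure_distr) simp_all
  then show ?thesis
    by (simp add: content_ball unit_ball_vol_pos less_imp_neq[symmetric])
qed

lemma AE_uniform_sphere_norm: "AE x in uniform_sphere. norm (x :: real ^ 'n) = 1"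
proof -
  have "AE x::real^'n in uniform_measure lborel (ball 0 1). norm (x /\<^sub>R norm x) = 1"
  proof (rule AE_uniform_measureI)
    have "AE x::real^'n in lborel. x \<noteq> 0"
      by (rule AE_lborel_singleton)
    then show "AE x::real^'n in lborel. x \<in> ball 0 1 \<longrightarrow> norm (x /\<^sub>R norm x) = 1"
      by eventually_elim auto
  qed simp
  then show ?thesis
    unfolding uniform_sphere_def by (subst AE_distr_iff) (auto)
qed

text \<open>The change of variables \<open>lborel_affine\<close> for a dilation, written with a
  preimage so that measurability of the set is immediate.\<close>

lemma measure_lborel_scaleR:
  fixes A :: "'a::euclidean_space set"
  assumes [measurable]: "A \<in> sets borel" and c: "c > 0"
  shows "measure lborel ((\<lambda>x. c *\<^sub>R x) -` A) * c ^ DIM('a) = measure lborel A"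
proof -
  have v: "(\<lambda>x::'a. c *\<^sub>R x) -` A \<in> sets borel"
    using measurable_sets[of "\<lambda>x::'a. c *\<^sub>R x" borel borel A] by simp
  have "emeasure lborel A = emeasure (density (distr lborel borel (\<lambda>x. 0 + c *\<^sub>R x)) (\<lambda>_. \<bar>c\<bar>^DIM('a))) A"
    using lborel_affine[of c "0::'a"] c by simp
  also have "\<dots> = ennreal (c ^ DIM('a)) * emeasure lborel ((\<lambda>x. c *\<^sub>R x) -` A)"
    using c by (simp add: emeasure_density nn_integral_cmult_indicator emeasure_distr v)
  finally show ?thesis
    using c by (simp add: measure_def enn2real_mult)
qed

text \<open>
  Converts between cone measure and volume near the sphere: the shell of thickness \<open>r\<close> carries a
  fraction of order \<open>r\<close> of the volume of a cone.
\<close>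
lemma measure_ucone_shell:
  fixes A :: "(real ^ 'n) set"
  assumes [measurable]: "A \<in> sets borel" and \<rho>: "0 < \<rho>" "\<rho> \<le> 1"
  shows "measure lborel {x \<in> ucone A. \<rho> \<le> norm x} = (1 - \<rho> ^ CARD('n)) * measure lborel (ucone A)"
proof -
  have m1: "{x \<in> ucone A. norm x < \<rho>} \<in> sets borel" "{x \<in> ucone A. \<rho> \<le> norm x} \<in> sets borel"
    by measurable
  \<comment> \<open>Normalisation ignores positive factors, so dilation by \<rho> carries the cone
    exactly onto its inner part.\<close>
  have "(\<lambda>x. \<rho> *\<^sub>R x) -` {x \<in> ucone A. norm x < \<rho>} = ucone A"
  proof -
    have "\<rho> * norm x < 1" if "norm x < 1" for x :: "real^'n"
      using that \<rho> by (metis mult_le_one norm_ge_zero mult_less_cancel_left2 le_less_trans mult_left_le_one_le less_imp_le)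
    moreover have "(\<rho> *\<^sub>R x) /\<^sub>R norm (\<rho> *\<^sub>R x) = x /\<^sub>R norm x" for x :: "real^'n"
      using \<rho> by simp
    moreover have "norm (\<rho> *\<^sub>R x) < \<rho> \<longleftrightarrow> norm x < 1" for x :: "real^'n"
      using \<rho> by simp
    ultimately show ?thesis
      using \<rho> by (auto simp only: vimage_eq mem_Collect_eq mem_ball_0) auto
  qed
  then have "measure lborel (ucone A) * \<rho> ^ CARD('n) = measure lborel {x \<in> ucone A. norm x < \<rho>}"
    using measure_lborel_scaleR[OF m1(1) \<rho>(1)] by simp
  moreover have "measure lborel (ucone A) = measure lborel {x \<in> ucone A. norm x < \<rho>}
      + measure lborel {x \<in> ucone A. \<rho> \<le> norm x}"
  proof (subst measure_Union[symmetric])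
    show "emeasure lborel {x \<in> ucone A. norm x < \<rho>} \<noteq> \<infinity>" "emeasure lborel {x \<in> ucone A. \<rho> \<le> norm x} \<noteq> \<infinity>"
      using fmeasurableD2[OF fmeasurableI2[OF fmeasurable_ucone[OF assms(1)]]] m1
      by (simp_all only: infinity_ennreal_def sets_lborel Collect_restrict not_False_eq_True)
    show "measure lborel (ucone A) = measure lborel ({x \<in> ucone A. norm x < \<rho>} \<union> {x \<in> ucone A. \<rho> \<le> norm x})"
      by (rule arg_cong[where f="measure lborel"]) auto
  qed (use m1 in auto)
  ultimately show ?thesis by (simp add: algebra_simps)
qed

section \<open>Caps and tubes\<close>

text \<open>The ball of radius \<open>r / 4\<close> about \<open>(1 - r / 4) *\<^sub>R u\<close>
  fits into the shell of thickness \<open>r / 2\<close> over the cap, because normalisation moves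
  its points by less than \<open>r / 2\<close>. Comparing volumes shows that the cap has measure at
  least of order \<open>r ^ (n - 1)\<close>.\<close>

lemma measure_cball_ge:
  fixes u :: "real ^ 'n"
  assumes u: "norm u = 1" and r: "0 < r" "r \<le> 1"
  shows "(r / 4) ^ CARD('n) \<le> real CARD('n) * (r / 2) * measure uniform_sphere (cball u r)"
proof -
  let ?n = "CARD('n)" and ?A = "cball u r"
  let ?V = "unit_ball_vol ?n"
  have V: "?V > 0" by (simp add: unit_ball_vol_pos)
  have meas [measurable]: "{x \<in> ucone ?A. 1 - r/2 \<le> norm x} \<in> sets borel" by measurable
  have sub: "ball ((1 - r/4) *\<^sub>R u) (r/4) \<subseteq> {x \<in> ucone ?A. 1 - r/2 \<le> norm x}"
  proof
    fix x assume "x \<in> ball ((1 - r/4) *\<^sub>R u) (r/4)"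
    then have d: "norm (x - (1 - r/4) *\<^sub>R u) < r/4" by (simp add: dist_norm norm_minus_commute)
    have nq: "norm ((1 - r/4) *\<^sub>R u) = 1 - r/4" using u r by simp
    have x1: "norm x < 1" using norm_triangle_ineq2[of x "(1 - r/4) *\<^sub>R u"] d nq by linarith
    have x2: "1 - r/2 < norm x"
      using norm_triangle_ineq3[of x "(1 - r/4) *\<^sub>R u"] d nq by linarith
    then have x0: "norm x > 0" using r by linarith
    have "norm (x /\<^sub>R norm x - x) = norm ((1 / norm x - 1) *\<^sub>R x)"
      by (simp add: scaleR_diff_left inverse_eq_divide)
    also have "\<dots> = 1 - norm x" using x0 x1 by (simp add: field_simps)
    finally have "norm (x /\<^sub>R norm x - x) < r/2" using x2 by linarith
    moreover have "norm ((1 - r/4) *\<^sub>R u - u) = r/4"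
    proof -
      have "(1 - r/4) *\<^sub>R u - u = (- r/4) *\<^sub>R u" by (simp add: scaleR_diff_left)
      then show ?thesis using u r by simp
    qed
    moreover have "norm (x /\<^sub>R norm x - u) = norm ((x /\<^sub>R norm x - x) + (x - (1 - r/4) *\<^sub>R u) + ((1 - r/4) *\<^sub>R u - u))"
      by simp
    ultimately have "norm (x /\<^sub>R norm x - u) \<le> r"
      using d norm_triangle_ineq[of "(x /\<^sub>R norm x - x) + (x - (1 - r/4) *\<^sub>R u)" "(1 - r/4) *\<^sub>R u - u"]
        norm_triangle_ineq[of "x /\<^sub>R norm x - x" "x - (1 - r/4) *\<^sub>R u"] by linarith
    then show "x \<in> {x \<in> ucone ?A. 1 - r/2 \<le> norm x}"
      using x1 x2 by (simp add: dist_norm norm_minus_commute)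
  qed
  have "?V * (r/4) ^ ?n = measure lborel (ball ((1 - r/4) *\<^sub>R u) (r/4))"
    using r by (simp add: content_ball)
  also have "\<dots> \<le> measure lborel {x \<in> ucone ?A. 1 - r/2 \<le> norm x}"
  proof (rule measure_mono_fmeasurable[OF sub])
    show "{x \<in> ucone ?A. 1 - r/2 \<le> norm x} \<in> fmeasurable lborel"
      by (rule fmeasurableI2[OF fmeasurable_cball[of 0 1]]) (use meas in auto)
  qed auto
  also have "\<dots> = (1 - (1 - r/2) ^ ?n) * measure lborel (ucone ?A)"
    using r by (intro measure_ucone_shell) auto
  \<comment> \<open>Bernoulli bounds the fraction of the cone that lies in the shell.\<close>
  also have "\<dots> \<le> (real ?n * (r/2)) * measure lborel (ucone ?A)"
    using Bernoulli_inequality[of "- r/2" ?n] r by (intro mult_right_mono) auto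
  also have "\<dots> = ?V * (real ?n * (r / 2) * measure uniform_sphere ?A)"
    by (subst measure_uniform_sphere[symmetric]) (simp_all only: borel_closed closed_cball mult_ac)
  finally show ?thesis using V by simp
qed

text \<open>Normalisation moves a point of norm at least \<open>1 - r\<close> by at most
  \<open>r\<close>, so the shell over the cap lies in a ball of radius \<open>2 * r\<close>, while
  it carries at least the fraction \<open>r\<close> of the cone. Keeping the factor \<open>r\<close>
  on the left avoids a truncated exponent.\<close>

lemma measure_cball_le:
  fixes x :: "real ^ 'n"
  assumes r: "0 < r" "r \<le> 1"
  shows "r * measure uniform_sphere (cball x r) \<le> (2 * r) ^ CARD('n)"
proof -
  let ?n = "CARD('n)" and ?A = "cball x r"
  let ?V = "unit_ball_vol ?n"
  have V: "?V > 0" by (simp add: unit_ball_vol_pos)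
  show ?thesis
  proof (cases "r = 1")
    \<comment> \<open>The shell of thickness 1 has inner radius 0, which the shell lemma
      excludes.\<close>
    case True
    have "measure uniform_sphere ?A \<le> 1" by simp
    also have "1 \<le> (2::real) ^ ?n" by simp
    finally show ?thesis using True by simp
  next
    case False
    with r have r1: "r < 1" by simp
    have meas [measurable]: "{x \<in> ucone ?A. 1 - r \<le> norm x} \<in> sets borel" by measurable
    have sub: "{x \<in> ucone ?A. 1 - r \<le> norm x} \<subseteq> cball x (2 * r)"
    proof
      fix y assume "y \<in> {x \<in> ucone ?A. 1 - r \<le> norm x}"
      then have y: "norm y < 1" "dist x (y /\<^sub>R norm y) \<le> r" "1 - r \<le> norm y" by auto
      then have y0: "norm y > 0" using r1 by linarith
      have "norm (y /\<^sub>R norm y - y) = norm ((1 / norm y - 1) *\<^sub>R y)"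
        by (simp add: scaleR_diff_left inverse_eq_divide)
      also have "\<dots> = 1 - norm y" using y0 y by (simp add: field_simps)
      finally have "dist (y /\<^sub>R norm y) y \<le> r" using y by (simp add: dist_norm)
      then show "y \<in> cball x (2 * r)"
        using dist_triangle[of x y "y /\<^sub>R norm y"] y by simp
    qed
    have "(1 - r) ^ ?n \<le> 1 - r"
      using power_decreasing[of 1 ?n "1 - r"] r by (simp add: Suc_leI)
    then have "r * measure lborel (ucone ?A) \<le> (1 - (1 - r) ^ ?n) * measure lborel (ucone ?A)"
      by (intro mult_right_mono) auto
    also have "\<dots> = measure lborel {x \<in> ucone ?A. 1 - r \<le> norm x}"
      using r r1 by (intro measure_ucone_shell[symmetric]) auto
    also have "\<dots> \<le> measure lborel (cball x (2 * r))"
      by (rule measure_mono_fmeasurable[OF sub]) (use meas fmeasurable_cball in auto)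
    also have "\<dots> = ?V * (2 * r) ^ ?n" using r by (simp add: content_cball)
    finally have "r * measure lborel (ucone ?A) \<le> ?V * (2 * r) ^ ?n" .
    moreover have "measure lborel (ucone ?A) = ?V * measure uniform_sphere ?A"
      by (rule measure_uniform_sphere[symmetric]) simp
    ultimately have "?V * (r * measure uniform_sphere ?A) \<le> ?V * (2 * r) ^ ?n"
      by (simp only: mult.left_commute)
    then show ?thesis using V by simp
  qed
qed

text \<open>A grid in the unit disc of the plane with at most \<open>(5 / r)\<^sup>2\<close> points
  gives balls of radius \<open>3 * r\<close> that cover the cone over the tube; each has volume of
  order \<open>r ^ n\<close>.\<close>

lemma measure_tube_le:
  fixes L :: "(real ^ 'n) set"
  assumes L: "subspace L" "dim L \<le> 2" and n: "CARD('n) \<ge> 2" and r: "0 < r" "r \<le> 1"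
  shows "measure uniform_sphere {y. infdist y (L \<inter> cball 0 1) \<le> r} \<le> 25 * 4 ^ CARD('n) * r ^ (CARD('n) - 2)"
    (is "measure _ ?A \<le> _")
proof -
  let ?n = "CARD('n)"
  let ?V = "unit_ball_vol ?n"
  have V: "?V > 0" by (simp add: unit_ball_vol_pos)
  have 0: "0 \<in> L" using L(1) subspace_0 by blast
  have cl: "closed (L \<inter> cball 0 1)" using L(1) closed_subspace by blast
  have [measurable]: "?A \<in> sets borel"
    by (intro borel_closed closed_Collect_le continuous_intros)
  define M where "M = nat \<lceil>1 / r\<rceil>"
  have M1: "1 / r \<le> real M" and M2: "real M \<le> 1 / r + 1"
    using r real_nat_ceiling_ge[of "1 / r"] of_int_ceiling_le_add_one[of "1 / r"]
    by (auto simp: M_def of_nat_nat)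
  have M0: "M > 0" using M1 r by (metis divide_pos_pos of_nat_0_less_iff order_less_le_trans zero_less_one)
  obtain G where G: "finite G" "card G \<le> (2 * M + 1) ^ dim L"
    "\<And>x. x \<in> L \<Longrightarrow> norm x \<le> 1 \<Longrightarrow> \<exists>g\<in>G. dist x g \<le> real (dim L) / real M"
    using subspace_net[OF L(1) M0] by metis
  have "1 / real M \<le> r" using M1 r M0 by (simp add: field_simps)
  then have dM: "real (dim L) / real M \<le> 2 * r"
    using L(2) M0 mult_mono[of "real (dim L)" 2 "1 / real M" r] by simp
  have "real (card G) \<le> real ((2 * M + 1) ^ 2)"
    using G(2) power_increasing[OF L(2), of "2 * M + 1"] by (simp only: of_nat_le_iff) linarith
  also have "\<dots> \<le> (5 / r)\<^sup>2"
  proof -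
    have "1 \<le> 1 / r" using r by simp
    then have "real (2 * M + 1) \<le> 5 / r" using M2 by simp
    then have "(real (2 * M + 1))\<^sup>2 \<le> (5 / r)\<^sup>2" by (rule power_mono) simp
    then show ?thesis by (simp only: of_nat_power)
  qed
  finally have cG: "real (card G) \<le> (5 / r)\<^sup>2" .
  have sub: "ucone ?A \<subseteq> (\<Union>g\<in>G. cball g (3 * r))"
  proof
    fix y assume "y \<in> ucone ?A"
    then have y: "norm y < 1" "infdist (y /\<^sub>R norm y) (L \<inter> cball 0 1) \<le> r" by auto
    obtain p where p: "p \<in> L" "norm p \<le> 1" "dist (y /\<^sub>R norm y) p \<le> r"
      using infdist_attains_inf[OF cl, of "y /\<^sub>R norm y"] 0 y(2) by force
    \<comment> \<open>Shrinking the nearest point \<open>p\<close> by \<open>norm y\<close> keeps it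
      in the disc and undoes the normalisation of \<open>y\<close>, so the distance to
      \<open>y\<close> is still at most \<open>r\<close>.\<close>
    let ?q = "norm y *\<^sub>R p"
    have q: "?q \<in> L" "norm ?q \<le> 1"
      using p y L(1) by (auto simp: subspace_scale mult_le_one)
    have "dist y ?q = norm y * dist (y /\<^sub>R norm y) p"
    proof (cases "y = 0")
      case False
      then have "y - ?q = norm y *\<^sub>R (y /\<^sub>R norm y - p)" by (simp add: scaleR_diff_right)
      then show ?thesis by (simp only: dist_norm norm_scaleR abs_norm_cancel)
    qed auto
    also have "\<dots> \<le> 1 * r" using y p r by (intro mult_mono) auto
    finally have "dist y ?q \<le> r" by simp
    moreover obtain g where "g \<in> G" "dist ?q g \<le> 2 * r"
      using G(3)[OF q] dM by force
    ultimately have "g \<in> G" "dist g y \<le> 3 * r"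
      using dist_triangle[of g y ?q] by (auto simp: dist_commute)
    then show "y \<in> (\<Union>g\<in>G. cball g (3 * r))" by auto
  qed
  have "?V * measure uniform_sphere ?A = measure lborel (ucone ?A)"
    by (simp add: measure_uniform_sphere)
  also have "\<dots> \<le> measure lborel (\<Union>g\<in>G. cball g (3 * r))"
  proof (rule measure_mono_fmeasurable[OF sub])
    show "ucone ?A \<in> sets lborel" by (simp only: sets_lborel) (rule sets_ucone, fact)
  qed (auto intro!: fmeasurable.finite_UN G(1) fmeasurable_cball)
  also have "\<dots> \<le> (\<Sum>g\<in>G. measure lborel (cball g (3 * r)))"
    using G(1) by (intro measure_UNION_le) auto
  also have "\<dots> = real (card G) * (?V * (3 * r) ^ ?n)"
    using r by (simp add: content_cball)
  also have "\<dots> \<le> (5 / r)\<^sup>2 * (?V * (3 * r) ^ ?n)"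
    using cG V r by (intro mult_right_mono) auto
  also have "\<dots> = ?V * (25 * 3 ^ ?n * (r ^ ?n / r\<^sup>2))"
    by (simp add: power_mult_distrib power_divide field_simps)
  also have "r ^ ?n / r\<^sup>2 = r ^ (?n - 2)"
    using n r by (simp add: power_diff)
  also have "?V * (25 * 3 ^ ?n * r ^ (?n - 2)) \<le> ?V * (25 * 4 ^ ?n * r ^ (?n - 2))"
    using V r by (intro mult_left_mono mult_right_mono power_mono) auto
  finally show ?thesis using V by simp
qed

subsection \<open>Random points\<close>

interpretation sphere_product: product_sigma_finite "\<lambda>_::nat. uniform_sphere :: (real ^ 'n) measure"
  by (simp add: product_sigma_finite_def uniform_sphere.sigma_finite_measure_axioms)

text \<open>Fubini with coordinate \<open>i\<close> outermost: for fixed \<open>a i\<close> the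
  remaining constraints involve distinct independent coordinates, and each costs at most
  \<open>q\<close>.\<close>

lemma nn_integral_cluster:
  fixes T :: "(real ^ 'n) set" and J :: "nat set"
  assumes [measurable]: "T \<in> sets borel" and J: "finite J" "I \<subseteq> J" "i \<in> I"
    and q: "\<And>x::real ^ 'n. emeasure uniform_sphere (cball x r) \<le> q"
  shows "(\<integral>\<^sup>+ a. indicator T (a i) * (\<Prod>j\<in>I - {i}. indicator {..r} (dist (a j) (a i)))
      \<partial>(\<Pi>\<^sub>M j\<in>J. uniform_sphere)) \<le> emeasure uniform_sphere T * q ^ (card I - 1)"
proof -
  have iJ: "i \<in> J" using J by blast
  define K where "K = J - {i}"
  have K: "finite K" "i \<notin> K" "J = insert i K" "I - {i} \<subseteq> K"
    using J iJ by (auto simp: K_def)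
  \<comment> \<open>The factor is constantly 1 outside \<open>I\<close>, which extends the product
    to all remaining coordinates, as the product formula for integrals requires.\<close>
  define g where "g = (\<lambda>(y::real^'n) j x. if j \<in> I then indicator {..r} (dist x y) else (1::ennreal))"
  have g_meas [measurable]: "g y j \<in> borel_measurable uniform_sphere" for y j
    unfolding g_def by measurable
  define f where "f = (\<lambda>a::nat \<Rightarrow> real^'n. indicator T (a i) * (\<Prod>j\<in>I - {i}. indicator {..r} (dist (a j) (a i))) :: ennreal)"
  have f_meas: "f \<in> borel_measurable (\<Pi>\<^sub>M j\<in>insert i K. uniform_sphere)"
    unfolding f_def
  proof (intro borel_measurable_times_ennreal borel_measurable_prod_ennreal)
    have c: "(\<lambda>a. a j) \<in> borel_measurable (\<Pi>\<^sub>M j\<in>insert i K. uniform_sphere :: (real^'n) measure)"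
      if "j \<in> insert i K" for j
      using measurable_component_singleton[OF that, of "\<lambda>_. uniform_sphere :: (real^'n) measure"]
      by (simp cong: measurable_cong_sets)
    have [measurable]: "(\<lambda>a. a i) \<in> borel_measurable (\<Pi>\<^sub>M j\<in>insert i K. uniform_sphere :: (real^'n) measure)"
      by (rule c) simp
    show "(\<lambda>a. indicator T (a i)) \<in> borel_measurable (\<Pi>\<^sub>M j\<in>insert i K. uniform_sphere :: (real^'n) measure)"
      by measurable
    fix j assume "j \<in> I - {i}"
    then have [measurable]: "(\<lambda>a. a j) \<in> borel_measurable (\<Pi>\<^sub>M j\<in>insert i K. uniform_sphere :: (real^'n) measure)"
      using K by (intro c) auto
    show "(\<lambda>a. indicator {..r} (dist (a j) (a i))) \<in> borel_measurable (\<Pi>\<^sub>M j\<in>insert i K. uniform_sphere :: (real^'n) measure)"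
      by measurable
  qed
  have fy: "f (x(i := y)) = indicator T y * (\<Prod>j\<in>K. g y j (x j))" for x y
  proof -
    have "(\<Prod>j\<in>K. g y j (x j)) = (\<Prod>j\<in>I - {i}. g y j (x j))"
      using K by (intro prod.mono_neutral_right) (auto simp: g_def)
    also have "\<dots> = (\<Prod>j\<in>I - {i}. indicator {..r} (dist ((x(i := y)) j) y))"
      by (intro prod.cong) (auto simp: g_def)
    finally show ?thesis by (simp add: f_def)
  qed
  have int: "(\<integral>\<^sup>+ x. f (x(i := y)) \<partial>(\<Pi>\<^sub>M j\<in>K. uniform_sphere)) \<le> indicator T y * q ^ (card I - 1)" for y
  proof -
    have comp: "(\<lambda>a. a j) \<in> borel_measurable (\<Pi>\<^sub>M j\<in>K. uniform_sphere :: (real^'n) measure)"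
      if "j \<in> K" for j
      using measurable_component_singleton[OF that, of "\<lambda>_. uniform_sphere :: (real^'n) measure"]
      by (simp cong: measurable_cong_sets)
    have "(\<lambda>x. \<Prod>j\<in>K. g y j (x j)) \<in> borel_measurable (\<Pi>\<^sub>M j\<in>K. uniform_sphere)"
      by (intro borel_measurable_prod_ennreal measurable_compose[OF comp]) (simp_all add: g_def)
    then have *: "(\<integral>\<^sup>+ x. f (x(i := y)) \<partial>(\<Pi>\<^sub>M j\<in>K. uniform_sphere)) =
        indicator T y * (\<integral>\<^sup>+ x. (\<Prod>j\<in>K. g y j (x j)) \<partial>(\<Pi>\<^sub>M j\<in>K. uniform_sphere))"
      unfolding fy by (rule nn_integral_cmult)
    have "(\<integral>\<^sup>+ x. (\<Prod>j\<in>K. g y j (x j)) \<partial>(\<Pi>\<^sub>M j\<in>K. uniform_sphere)) =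
        (\<Prod>j\<in>K. \<integral>\<^sup>+ x. g y j x \<partial>uniform_sphere)"
      by (rule sphere_product.product_nn_integral_prod[OF K(1)]) measurable
    \<comment> \<open>Unconstrained coordinates integrate to 1, the total mass.\<close>
    also have "\<dots> = (\<Prod>j\<in>I - {i}. \<integral>\<^sup>+ x. g y j x \<partial>uniform_sphere)"
      using K uniform_sphere.emeasure_space_1
      by (intro prod.mono_neutral_right) (auto simp: g_def)
    also have "\<dots> \<le> (\<Prod>j\<in>I - {i}. q)"
    proof (rule prod_mono_ennreal)
      fix j assume "j \<in> I - {i}"
      then have "(\<integral>\<^sup>+ x. g y j x \<partial>uniform_sphere) = (\<integral>\<^sup>+ x. indicator (cball y r) x \<partial>uniform_sphere)"
        by (intro nn_integral_cong) (auto simp: g_def indicator_def dist_commute)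
      then show "(\<integral>\<^sup>+ x. g y j x \<partial>uniform_sphere) \<le> q" using q[of y] by simp
    qed
    also have "(\<Prod>j\<in>I - {i}. q) = q ^ (card I - 1)" using J by simp
    finally show ?thesis unfolding * by (rule mult_left_mono) simp
  qed
  have "(\<integral>\<^sup>+ a. f a \<partial>(\<Pi>\<^sub>M j\<in>J. uniform_sphere)) =
      (\<integral>\<^sup>+ y. \<integral>\<^sup>+ x. f (x(i := y)) \<partial>(\<Pi>\<^sub>M j\<in>K. uniform_sphere) \<partial>uniform_sphere)"
    unfolding K(3) by (rule sphere_product.product_nn_integral_insert_rev[OF K(1,2) f_meas])
  also have "\<dots> \<le> (\<integral>\<^sup>+ y. indicator T y * q ^ (card I - 1) \<partial>uniform_sphere)"
    by (intro nn_integral_mono int)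
  also have "\<dots> = emeasure uniform_sphere T * q ^ (card I - 1)"
    by (simp add: nn_integral_multc)
  finally show ?thesis by (simp add: f_def)
qed

section \<open>Counting small index sets\<close>

lemma binomial_le_power: "n choose k \<le> n ^ k"
  by (cases "k \<le> n") (simp_all add: binomial_le_pow binomial_eq_0)

text \<open>Group the sets by size: at most \<open>card J ^ Suc s\<close> of them have
  \<open>Suc s\<close> elements, and each contributes \<open>y ^ s\<close>.\<close>

lemma sum_index_sets_le:
  fixes y :: real
  assumes "finite J" "0 \<le> y"
  shows "(\<Sum>I\<in>index_sets J (Suc N) - {{}}. y ^ (card I - 1))
    \<le> real (card J) * (\<Sum>s\<le>N. (real (card J) * y) ^ s)"
proof -
  let ?S = "index_sets J (Suc N) - {{}}"
  have fS: "finite ?S" using assms finite_index_sets by blast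
  have "card I \<in> Suc ` {..N}" if "I \<in> ?S" for I
  proof -
    have "I \<subseteq> J" "I \<noteq> {}" "card I \<le> Suc N" using that by (auto simp: index_sets_def)
    moreover have "card I \<noteq> 0" using calculation assms finite_subset by fastforce
    ultimately show ?thesis by (intro image_eqI[of _ _ "card I - 1"]) auto
  qed
  then have "(\<Sum>I\<in>?S. y ^ (card I - 1)) =
      (\<Sum>s\<in>Suc ` {..N}. \<Sum>I\<in>{I\<in>?S. card I = s}. y ^ (card I - 1))"
    by (intro sum.group[symmetric] fS) auto
  also have "\<dots> = (\<Sum>s\<le>N. \<Sum>I\<in>{I\<in>?S. card I = Suc s}. y ^ (card I - 1))"
    by (simp add: sum.reindex)
  also have "\<dots> \<le> (\<Sum>s\<le>N. real (card J) * (real (card J) * y) ^ s)"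
  proof (rule sum_mono)
    fix s
    have "card {I\<in>?S. card I = Suc s} \<le> card {I. I \<subseteq> J \<and> card I = Suc s}"
      using assms by (intro card_mono) (auto simp: index_sets_def)
    also have "\<dots> = card J choose Suc s" using assms by (simp add: n_subsets)
    also have "\<dots> \<le> card J ^ Suc s"
      by (rule binomial_le_power)
    finally have "real (card {I\<in>?S. card I = Suc s}) \<le> real (card J) ^ Suc s"
      by (metis of_nat_le_iff of_nat_power)
    then have "real (card {I\<in>?S. card I = Suc s}) * y ^ s \<le> real (card J) ^ Suc s * y ^ s"
      using assms by (intro mult_right_mono) auto
    moreover have "(\<Sum>I\<in>{I\<in>?S. card I = Suc s}. y ^ (card I - 1)) = (\<Sum>I\<in>{I\<in>?S. card I = Suc s}. y ^ s)"
      by (intro sum.cong) auto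
    ultimately show "(\<Sum>I\<in>{I\<in>?S. card I = Suc s}. y ^ (card I - 1)) \<le> real (card J) * (real (card J) * y) ^ s"
      by (simp add: power_mult_distrib mult_ac)
  qed
  finally show ?thesis by (simp only: sum_distrib_left)
qed

lemma card_index_sets_le:
  assumes "finite J" "J \<noteq> {}"
  shows "card (index_sets J N) \<le> (N + 1) * card J ^ N"
proof -
  have "index_sets J N = (\<Union>s\<le>N. {I. I \<subseteq> J \<and> card I = s})"
    by (auto simp: index_sets_def)
  then have "card (index_sets J N) \<le> (\<Sum>s\<le>N. card {I. I \<subseteq> J \<and> card I = s})"
    using card_UN_le[of "{..N}" "\<lambda>s. {I. I \<subseteq> J \<and> card I = s}"] by simp
  also have "\<dots> \<le> (\<Sum>s\<le>N. card J ^ N)"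
  proof (rule sum_mono)
    fix s assume "s \<in> {..N}"
    have "card {I. I \<subseteq> J \<and> card I = s} = card J choose s" using assms by (simp add: n_subsets)
    also have "\<dots> \<le> card J ^ s"
      by (rule binomial_le_power)
    also have "\<dots> \<le> card J ^ N"
      using \<open>s \<in> {..N}\<close> assms by (intro power_increasing) (auto simp: Suc_le_eq card_gt_0_iff)
    finally show "card {I. I \<subseteq> J \<and> card I = s} \<le> card J ^ N" .
  qed
  finally show ?thesis by simp
qed

text \<open>The indicator of \<open>clustered\<close> as a product, so that Fubini applies with the point of index \<open>Min I\<close> outermost.\<close>
definition cluster_weight :: "(real ^ 'n) set \<Rightarrow> real \<Rightarrow> (nat \<Rightarrow> real ^ 'n) \<Rightarrow> nat set \<Rightarrow> ennreal" where
  "cluster_weight L \<delta> a I = indicator {y. infdist y (L \<inter> cball 0 1) \<le> 2 * \<delta>} (a (Min I)) *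
     (\<Prod>j\<in>I - {Min I}. indicator {..4 * \<delta>} (dist (a j) (a (Min I))))"

lemma cluster_weight_eq:
  assumes "finite I"
  shows "cluster_weight L \<delta> a I = (if clustered L \<delta> a I then 1 else 0)"
  using assms by (auto simp: cluster_weight_def clustered_def indicator_def prod_zero_iff)

text \<open>Makes the count a finite sum of weights, which yields both its measurability and its
  expectation term by term.\<close>

lemma card_cluster_sets_eq:
  fixes a :: "nat \<Rightarrow> real ^ 'n"
  shows "of_nat (card (cluster_sets L \<delta> m a)) =
    (\<Sum>I\<in>index_sets {1..m} (CARD('n) + 1) - {{}}. cluster_weight L \<delta> a I)"
proof -
  let ?S = "index_sets {1..m} (CARD('n) + 1) - {{}}"
  have fS: "finite ?S" by (simp add: finite_index_sets)
  have "finite I" if "I \<in> ?S" for I using that finite_subset by (auto simp: index_sets_def)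
  then have "(\<Sum>I\<in>?S. cluster_weight L \<delta> a I) = (\<Sum>I\<in>?S. if clustered L \<delta> a I then 1 else 0)"
    by (intro sum.cong) (auto simp: cluster_weight_eq)
  also have "\<dots> = of_nat (card {I \<in> ?S. clustered L \<delta> a I})"
    using fS by (simp add: sum.If_cases Int_def)
  also have "{I \<in> ?S. clustered L \<delta> a I} = cluster_sets L \<delta> m a"
    by (auto simp: cluster_sets_def)
  finally show ?thesis by simp
qed

lemma measurable_cluster_weight:
  fixes L :: "(real ^ 'n) set"
  assumes I: "I \<in> index_sets {1..m} N - {{}}"
  shows "(\<lambda>a. cluster_weight L \<delta> a I) \<in> borel_measurable (\<Pi>\<^sub>M i\<in>{1..m}. uniform_sphere)"
proof -
  have sub: "I \<subseteq> {1..m}" "I \<noteq> {}" using I by (auto simp: index_sets_def)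
  then have mI: "Min I \<in> I" by (meson Min_in finite_atLeastAtMost finite_subset)
  have c: "(\<lambda>a. a j) \<in> borel_measurable (\<Pi>\<^sub>M i\<in>{1..m}. uniform_sphere :: (real^'n) measure)"
    if "j \<in> I" for j
    using measurable_component_singleton[of j "{1..m}" "\<lambda>_. uniform_sphere :: (real^'n) measure"] that sub
    by (auto cong: measurable_cong_sets)
  note c[OF mI, measurable]
  have [measurable]: "{y::real^'n. infdist y (L \<inter> cball 0 1) \<le> 2 * \<delta>} \<in> sets borel"
    by (intro borel_closed closed_Collect_le continuous_intros)
  show ?thesis
    unfolding cluster_weight_def
  proof (intro borel_measurable_times_ennreal borel_measurable_prod_ennreal)
    fix j assume "j \<in> I - {Min I}"
    then have [measurable]: "(\<lambda>a. a j) \<in> borel_measurable (\<Pi>\<^sub>M i\<in>{1..m}. uniform_sphere :: (real^'n) measure)"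
      using c by blast
    show "(\<lambda>a. indicator {..4 * \<delta>} (dist (a j) (a (Min I)))) \<in>
        borel_measurable (\<Pi>\<^sub>M i\<in>{1..m}. uniform_sphere :: (real^'n) measure)"
      by measurable
  qed measurable
qed

text \<open>Linearity of expectation over the index sets: the point of least index pays the tube
  probability, every further point the probability of a ball.\<close>

lemma nn_integral_card_cluster_sets_le:
  fixes L :: "(real ^ 'n) set"
  assumes L: "subspace L" "dim L \<le> 2" and n: "CARD('n) \<ge> 2" and \<delta>: "0 < \<delta>" "\<delta> \<le> 1 / 4"
  shows "(\<integral>\<^sup>+ a. of_nat (card (cluster_sets L \<delta> m a)) \<partial>(\<Pi>\<^sub>M i\<in>{1..m}. uniform_sphere))
    \<le> ennreal (25 * 8 ^ CARD('n) * \<delta> ^ (CARD('n) - 2) *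
        (real m * (\<Sum>s\<le>CARD('n). (real m * (8 ^ CARD('n) * \<delta> ^ (CARD('n) - 1))) ^ s)))"
proof -
  let ?n = "CARD('n)"
  let ?S = "index_sets {1..m} (?n + 1) - {{}}"
  let ?T = "{y. infdist y (L \<inter> cball 0 1) \<le> 2 * \<delta>}"
  \<comment> \<open>The tube bound at radius \<open>2 * \<delta>\<close>, with
    \<open>4 ^ n * 2 ^ (n - 2)\<close> rounded up to \<open>8 ^ n\<close>.\<close>
  define t where "t = 25 * 8 ^ ?n * \<delta> ^ (?n - 2)"
  \<comment> \<open>The cap bound at radius \<open>4 * \<delta>\<close>, where
    \<open>(8 * \<delta>) ^ n\<close> is divided by \<open>4 * \<delta>\<close> and the gain of
    \<open>1 / 4\<close> is given away.\<close>
  define q where "q = 8 ^ ?n * \<delta> ^ (?n - 1)"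
  have t0: "t \<ge> 0" and q0: "q \<ge> 0" using \<delta> by (auto simp: t_def q_def)
  have T [measurable]: "?T \<in> sets borel"
    by (intro borel_closed closed_Collect_le continuous_intros)
  have "measure uniform_sphere ?T \<le> 25 * 4 ^ ?n * (2 * \<delta>) ^ (?n - 2)"
    using measure_tube_le[OF L n, of "2 * \<delta>"] \<delta> by simp
  also have "\<dots> = (25 * 4 ^ ?n * 2 ^ (?n - 2)) * \<delta> ^ (?n - 2)"
    by (simp add: power_mult_distrib)
  also have "\<dots> \<le> (25 * 4 ^ ?n * 2 ^ ?n) * \<delta> ^ (?n - 2)"
    using \<delta> by (intro mult_right_mono mult_left_mono power_increasing) auto
  also have "\<dots> = t"
    by (simp add: t_def power_mult_distrib[symmetric])
  finally have tT: "emeasure uniform_sphere ?T \<le> ennreal t"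
    by (simp add: uniform_sphere.emeasure_eq_measure ennreal_leI)
  have qb: "emeasure uniform_sphere (cball x (4 * \<delta>)) \<le> ennreal q" for x :: "real^'n"
  proof -
    have "4 * \<delta> * measure uniform_sphere (cball x (4 * \<delta>)) \<le> (2 * (4 * \<delta>)) ^ ?n"
      using measure_cball_le[of "4 * \<delta>" x] \<delta> by simp
    also have "\<dots> = 8 ^ ?n * \<delta> ^ ?n" by (simp add: power_mult_distrib)
    also have "\<delta> ^ ?n = \<delta> * \<delta> ^ (?n - 1)" using power_minus_mult[of ?n \<delta>] by (simp add: mult.commute)
    finally have "\<delta> * (4 * measure uniform_sphere (cball x (4 * \<delta>))) \<le> \<delta> * q"
      by (simp add: q_def mult_ac)
    then have "4 * measure uniform_sphere (cball x (4 * \<delta>)) \<le> q" using \<delta> by simp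
    then have "measure uniform_sphere (cball x (4 * \<delta>)) \<le> q"
      using measure_nonneg[of uniform_sphere "cball x (4 * \<delta>)"] by linarith
    then show ?thesis by (simp add: uniform_sphere.emeasure_eq_measure ennreal_leI)
  qed
  have "(\<integral>\<^sup>+ a. of_nat (card (cluster_sets L \<delta> m a)) \<partial>(\<Pi>\<^sub>M i\<in>{1..m}. uniform_sphere)) =
      (\<Sum>I\<in>?S. \<integral>\<^sup>+ a. cluster_weight L \<delta> a I \<partial>(\<Pi>\<^sub>M i\<in>{1..m}. uniform_sphere))"
    unfolding card_cluster_sets_eq by (intro nn_integral_sum measurable_cluster_weight)
  also have "\<dots> \<le> (\<Sum>I\<in>?S. ennreal (t * q ^ (card I - 1)))"
  proof (rule sum_mono)
    fix I assume I: "I \<in> ?S"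
    then have sub: "I \<subseteq> {1..m}" "I \<noteq> {}" by (auto simp: index_sets_def)
    then have mI: "Min I \<in> I" by (meson Min_in finite_atLeastAtMost finite_subset)
    have "(\<integral>\<^sup>+ a. cluster_weight L \<delta> a I \<partial>(\<Pi>\<^sub>M i\<in>{1..m}. uniform_sphere))
        \<le> emeasure uniform_sphere ?T * ennreal q ^ (card I - 1)"
      unfolding cluster_weight_def by (rule nn_integral_cluster[OF T _ sub(1) mI qb]) simp
    also have "\<dots> \<le> ennreal t * ennreal q ^ (card I - 1)"
      by (intro mult_right_mono tT) simp
    also have "\<dots> = ennreal (t * q ^ (card I - 1))"
      using t0 q0 by (simp add: ennreal_mult ennreal_power)
    finally show "(\<integral>\<^sup>+ a. cluster_weight L \<delta> a I \<partial>(\<Pi>\<^sub>M i\<in>{1..m}. uniform_sphere))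
        \<le> ennreal (t * q ^ (card I - 1))" .
  qed
  also have "\<dots> = ennreal (t * (\<Sum>I\<in>?S. q ^ (card I - 1)))"
    using t0 q0 by (simp add: sum_ennreal sum_distrib_left)
  also have "\<dots> \<le> ennreal (t * (real m * (\<Sum>s\<le>?n. (real m * q) ^ s)))"
    using sum_index_sets_le[of "{1..m}" q ?n] q0 t0 by (intro ennreal_leI mult_left_mono) auto
  finally show ?thesis by (simp only: t_def q_def)
qed

text \<open>
  No measurability of \<open>f\<close> is needed: on non-measurable functions \<open>nn_integral\<close> is a lower
  integral, so only the simple functions below \<open>f\<close> matter.
\<close>
lemma nn_integral_pair_le:
  assumes M: "prob_space N" and le: "\<And>v. v \<in> space N \<Longrightarrow> (\<integral>\<^sup>+ a. f a v \<partial>M) \<le> B" and "sigma_finite_measure M"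
  shows "(\<integral>\<^sup>+ (a, v). f a v \<partial>(M \<Otimes>\<^sub>M N)) \<le> B"
proof -
  interpret N: prob_space N by fact
  interpret M: sigma_finite_measure M by fact
  interpret pair_sigma_finite M N by standard
  show ?thesis
    unfolding nn_integral_def[of "M \<Otimes>\<^sub>M N"]
  proof (rule SUP_least)
    fix g assume "g \<in> {g. simple_function (M \<Otimes>\<^sub>M N) g \<and> g \<le> (\<lambda>(a, v). f a v)}"
    then have g: "simple_function (M \<Otimes>\<^sub>M N) g" and gf: "\<And>a v. g (a, v) \<le> f a v"
      by (auto simp: le_fun_def)
    have [measurable]: "g \<in> borel_measurable (M \<Otimes>\<^sub>M N)"
      using g by (rule borel_measurable_simple_function)
    have "integral\<^sup>S (M \<Otimes>\<^sub>M N) g = (\<integral>\<^sup>+ x. g x \<partial>(M \<Otimes>\<^sub>M N))"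
      using g by (rule nn_integral_eq_simple_integral[symmetric])
    also have "\<dots> = (\<integral>\<^sup>+ v. \<integral>\<^sup>+ a. g (a, v) \<partial>M \<partial>N)"
      by (rule nn_integral_snd[symmetric]) simp
    also have "\<dots> \<le> (\<integral>\<^sup>+ v. B \<partial>N)"
      using gf by (intro nn_integral_mono order_trans[OF nn_integral_mono le]) auto
    also have "\<dots> = B" by (simp add: N.emeasure_space_1)
    finally show "integral\<^sup>S (M \<Otimes>\<^sub>M N) g \<le> B" .
  qed
qed

section \<open>The event that some ball of the net is missed\<close>

text \<open>A measurable substitute for failure of density: only finitely many balls have to be
  hit.\<close>

definition sparse :: "(real ^ 'n) set \<Rightarrow> real \<Rightarrow> nat \<Rightarrow> (nat \<Rightarrow> real ^ 'n) set" where
  "sparse G s m = (\<Union>g\<in>G. {1..m} \<rightarrow>\<^sub>E - cball g s)"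

lemma sets_sparse:
  assumes "finite G"
  shows "sparse G s m \<in> sets (\<Pi>\<^sub>M i\<in>{1..m}. uniform_sphere)"
  unfolding sparse_def using assms by (intro sets.finite_UN sets_PiM_I_finite) auto

text \<open>Each ball about a net point contains a cap of measure at least some \<open>p\<close>, so
  by independence all points miss it with probability at most \<open>(1 - p) ^ m\<close>, hence at
  most \<open>exp (- m * p)\<close>. A union bound over \<open>G\<close> finishes.\<close>

lemma emeasure_sparse_le:
  fixes G :: "(real ^ 'n) set"
  assumes G: "finite G" "\<And>g. g \<in> G \<Longrightarrow> \<exists>u. norm u = 1 \<and> dist u g \<le> \<delta> / 4" and \<delta>: "0 < \<delta>" "\<delta> \<le> 1"
  shows "emeasure (\<Pi>\<^sub>M i\<in>{1..m}. uniform_sphere) (sparse G (\<delta> / 2) m)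
    \<le> ennreal (real (card G) * exp (- real m * (8 / (real CARD('n) * 16 ^ CARD('n)) * \<delta> ^ (CARD('n) - 1))))"
proof -
  let ?n = "CARD('n)"
  \<comment> \<open>The lower bound for a cap of radius \<open>\<delta> / 4\<close>, solved for the
    measure.\<close>
  let ?p = "8 / (real ?n * 16 ^ ?n) * \<delta> ^ (?n - 1)"
  have n0: "real ?n > 0" by simp
  have g: "emeasure uniform_sphere (- cball g (\<delta> / 2)) \<le> ennreal (exp (- ?p))" if gG: "g \<in> G" for g
  proof -
    obtain u where u: "norm u = 1" "dist u g \<le> \<delta> / 4" using G(2)[OF gG] by blast
    have sub: "cball u (\<delta> / 4) \<subseteq> cball g (\<delta> / 2)"
    proof
      fix x assume "x \<in> cball u (\<delta> / 4)"
      then show "x \<in> cball g (\<delta> / 2)"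
        using u(2) dist_triangle[of g x u] by (simp add: dist_commute)
    qed
    have "(\<delta> / 4 / 4) ^ ?n \<le> real ?n * (\<delta> / 4 / 2) * measure uniform_sphere (cball u (\<delta> / 4))"
      using measure_cball_ge[OF u(1), of "\<delta> / 4"] \<delta> by simp
    moreover have "(\<delta> / 4 / 4) ^ ?n = \<delta> * \<delta> ^ (?n - 1) / 16 ^ ?n"
      using power_minus_mult[of ?n \<delta>] by (simp add: power_divide mult.commute)
    ultimately have "\<delta> * (\<delta> ^ (?n - 1) / 16 ^ ?n) \<le> \<delta> * (real ?n / 8 * measure uniform_sphere (cball u (\<delta> / 4)))"
      by (simp add: mult_ac)
    then have "\<delta> ^ (?n - 1) / 16 ^ ?n \<le> real ?n / 8 * measure uniform_sphere (cball u (\<delta> / 4))"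
      using \<delta> by (simp only: mult_le_cancel_left_pos)
    then have "8 / real ?n * (\<delta> ^ (?n - 1) / 16 ^ ?n)
        \<le> 8 / real ?n * (real ?n / 8 * measure uniform_sphere (cball u (\<delta> / 4)))"
      by (intro mult_left_mono) auto
    then have "?p \<le> measure uniform_sphere (cball u (\<delta> / 4))" by simp
    also have "\<dots> \<le> measure uniform_sphere (cball g (\<delta> / 2))"
      using sub by (intro uniform_sphere.finite_measure_mono) auto
    finally have "?p \<le> measure uniform_sphere (cball g (\<delta> / 2))" .
    moreover have "measure uniform_sphere (- cball g (\<delta> / 2)) = 1 - measure uniform_sphere (cball g (\<delta> / 2))"
      using uniform_sphere.prob_compl[of "cball g (\<delta> / 2)"] by (simp add: Compl_eq_Diff_UNIV)
    ultimately have "measure uniform_sphere (- cball g (\<delta> / 2)) \<le> exp (- ?p)"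
      using exp_ge_add_one_self[of "- ?p"] by linarith
    then show ?thesis by (simp add: uniform_sphere.emeasure_eq_measure ennreal_leI)
  qed
  have "emeasure (\<Pi>\<^sub>M i\<in>{1..m}. uniform_sphere) (sparse G (\<delta> / 2) m)
      \<le> (\<Sum>g\<in>G. emeasure (\<Pi>\<^sub>M i\<in>{1..m}. uniform_sphere) ({1..m} \<rightarrow>\<^sub>E - cball g (\<delta> / 2)))"
    unfolding sparse_def using G(1)
    by (intro emeasure_subadditive_finite) (auto intro!: sets_PiM_I_finite)
  also have "\<dots> \<le> (\<Sum>g\<in>G. ennreal (exp (- real m * ?p)))"
  proof (rule sum_mono)
    fix g assume "g \<in> G"
    have "emeasure (\<Pi>\<^sub>M i\<in>{1..m}. uniform_sphere) ({1..m} \<rightarrow>\<^sub>E - cball g (\<delta> / 2)) =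
        (\<Prod>i\<in>{1..m}. emeasure uniform_sphere (- cball g (\<delta> / 2)))"
      by (rule sphere_product.emeasure_PiM) auto
    also have "\<dots> \<le> (\<Prod>i\<in>{1..m}. ennreal (exp (- ?p)))"
      using g[OF \<open>g \<in> G\<close>] by (intro prod_mono_ennreal)
    also have "\<dots> = ennreal (exp (- real m * ?p))"
      by (simp add: ennreal_power exp_of_nat_mult[symmetric])
    finally show "emeasure (\<Pi>\<^sub>M i\<in>{1..m}. uniform_sphere) ({1..m} \<rightarrow>\<^sub>E - cball g (\<delta> / 2))
        \<le> ennreal (exp (- real m * ?p))" .
  qed
  also have "\<dots> = ennreal (real (card G) * exp (- real m * ?p))"
    by (simp add: ennreal_mult ennreal_of_nat_eq_real_of_nat)
  finally show ?thesis .
qed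

subsection \<open>The expected number of steps\<close>

text \<open>For fixed \<open>v\<close>, each stage is charged the trivial bound on the sparse event
  plus the number of cluster sets. The resulting bound does not depend on \<open>v\<close>, so it
  survives the integration over \<open>v\<close>.\<close>

lemma expected_pivot_steps_le:
  fixes e :: "nat \<Rightarrow> real ^ 'n"
  assumes e: "bij_betw e {1..CARD('n)} Basis" and n: "CARD('n) \<ge> 2"
    and G: "finite G" "\<And>g. g \<in> G \<Longrightarrow> \<exists>u. norm u = 1 \<and> dist u g \<le> \<delta> / 4"
    and net: "\<And>u::real^'n. norm u = 1 \<Longrightarrow> \<exists>g\<in>G. dist u g \<le> \<delta> / 4"
    and \<delta>: "0 < \<delta>" "\<delta> \<le> 1 / 4"
  shows "expected_pivot_steps e m \<le> ennreal (real CARD('n) *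
    (real (card (index_sets {0..m} (CARD('n) + 1))) *
       (real (card G) * exp (- real m * (8 / (real CARD('n) * 16 ^ CARD('n)) * \<delta> ^ (CARD('n) - 1)))) +
     25 * 8 ^ CARD('n) * \<delta> ^ (CARD('n) - 2) *
        (real m * (\<Sum>s\<le>CARD('n). (real m * (8 ^ CARD('n) * \<delta> ^ (CARD('n) - 1))) ^ s))))"
proof -
  let ?n = "CARD('n)"
  let ?M = "\<Pi>\<^sub>M i\<in>{1..m}. uniform_sphere :: (real^'n) measure"
  let ?B = "sparse G (\<delta> / 2) m"
  define N where "N = card (index_sets {0..m} (?n + 1))"
  define b where "b = real (card G) * exp (- real m * (8 / (real CARD('n) * 16 ^ CARD('n)) * \<delta> ^ (CARD('n) - 1)))"
  define c where "c = 25 * 8 ^ CARD('n) * \<delta> ^ (CARD('n) - 2) *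
        (real m * (\<Sum>s\<le>CARD('n). (real m * (8 ^ CARD('n) * \<delta> ^ (CARD('n) - 1))) ^ s))"
  have b0: "b \<ge> 0" and c0: "c \<ge> 0"
    using \<delta> by (auto simp: b_def c_def intro!: mult_nonneg_nonneg sum_nonneg)
  have B: "?B \<in> sets ?M" by (rule sets_sparse[OF G(1)])
  have eB: "emeasure ?M ?B \<le> ennreal b"
    unfolding b_def using \<delta> by (intro emeasure_sparse_le[OF G]) auto
  have "(\<integral>\<^sup>+ a. pivot_steps e m a v \<partial>?M) \<le> ennreal (real ?n * (real N * b + c))" for v
  proof -
    let ?X = "\<lambda>a k. of_nat N * indicator ?B a + of_nat (card (cluster_sets (stage_plane e v k) \<delta> m a)) :: ennreal"
    have X_meas: "(\<lambda>a. of_nat (card (cluster_sets L \<delta> m a)) :: ennreal) \<in> borel_measurable ?M"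
      for L :: "(real^'n) set"
      unfolding card_cluster_sets_eq by (intro borel_measurable_sum measurable_cluster_weight)
    have "AE a in ?M. \<forall>i\<in>{1..m}. norm (a i) = 1"
      by (intro AE_finite_allI AE_PiM_component[where M="\<lambda>_. uniform_sphere"] AE_uniform_sphere_norm
          uniform_sphere.prob_space_axioms) auto
    then have "AE a in ?M. pivot_steps e m a v \<le> (\<Sum>k=2..?n. ?X a k)"
      using AE_space
    proof eventually_elim
      case (elim a)
      have "of_nat (card (proper_edges e m a v k)) \<le> ?X a k" if k: "k \<in> {2..?n}" for k
      proof (cases "a \<in> ?B")
        case True
        have "(of_nat (card (proper_edges e m a v k)) :: ennreal) \<le> of_nat N"
          using proper_edges_card_le(2)[of e m a v k] by (simp add: N_def)
        also have "\<dots> \<le> ?X a k" using True by simp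
        finally show ?thesis .
      next
        case False
        have "\<exists>j\<in>{1..m}. dist (a j) u \<le> \<delta>" if u: "norm u = 1" for u
        proof -
          obtain g where g: "g \<in> G" "dist u g \<le> \<delta> / 4" using net[OF u] by blast
          have "a \<notin> {1..m} \<rightarrow>\<^sub>E - cball g (\<delta> / 2)" using False g by (auto simp: sparse_def)
          \<comment> \<open>Points of the product space are extensional, so \<open>a\<close> can
            avoid the extensional product only through a coordinate lying in the ball.\<close>
          moreover have "a \<in> extensional {1..m}" using elim(2) by (auto simp: space_PiM PiE_def)
          ultimately obtain j where "j \<in> {1..m}" "dist g (a j) \<le> \<delta> / 2"
            by (auto simp: PiE_def Pi_def)
          then show ?thesis
            using g(2) \<delta> dist_triangle[of "a j" u g] by (intro bexI[of _ j]) (auto simp: dist_commute)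
        qed
        then have "card (proper_edges e m a v k) \<le> card (cluster_sets (stage_plane e v k) \<delta> m a)"
          using elim(1) \<delta> k by (intro proper_edges_card_le_cluster_sets[OF e]) auto
        then show ?thesis using False by simp
      qed
      then show ?case
        by (intro order_trans[OF pivot_steps_le[OF n]] sum_mono)
    qed
    then have "(\<integral>\<^sup>+ a. pivot_steps e m a v \<partial>?M) \<le> (\<integral>\<^sup>+ a. (\<Sum>k=2..?n. ?X a k) \<partial>?M)"
      by (rule nn_integral_mono_AE)
    also have "\<dots> = (\<Sum>k=2..?n. \<integral>\<^sup>+ a. ?X a k \<partial>?M)"
      by (intro nn_integral_sum borel_measurable_add borel_measurable_times_ennreal X_meas
          borel_measurable_indicator B) simp
    also have "\<dots> \<le> (\<Sum>k=2..?n. ennreal (real N * b + c))"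
    proof (rule sum_mono)
      fix k
      have "(\<integral>\<^sup>+ a. ?X a k \<partial>?M) = of_nat N * emeasure ?M ?B +
          (\<integral>\<^sup>+ a. of_nat (card (cluster_sets (stage_plane e v k) \<delta> m a)) \<partial>?M)"
        using B X_meas by (subst nn_integral_add) (auto simp: nn_integral_cmult_indicator)
      also have "\<dots> \<le> of_nat N * ennreal b + ennreal c"
        unfolding c_def
        by (intro add_mono mult_left_mono eB
            nn_integral_card_cluster_sets_le[OF subspace_stage_plane dim_stage_plane n \<delta>]) simp
      also have "\<dots> = ennreal (real N * b + c)"
        using b0 c0 by (simp add: ennreal_mult ennreal_plus ennreal_of_nat_eq_real_of_nat)
      finally show "(\<integral>\<^sup>+ a. ?X a k \<partial>?M) \<le> ennreal (real N * b + c)" .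
    qed
    also have "\<dots> = of_nat (card {2..?n}) * ennreal (real N * b + c)" by (rule sum_constant)
    \<comment> \<open>There are \<open>n - 1\<close> stages, rounded up to \<open>n\<close>.\<close>
    also have "\<dots> \<le> of_nat ?n * ennreal (real N * b + c)"
      by (intro mult_right_mono) (auto simp del: of_nat_diff)
    also have "\<dots> = ennreal (real ?n * (real N * b + c))"
      using b0 c0 by (subst ennreal_mult) (auto simp only: ennreal_of_nat_eq_real_of_nat of_nat_0_le_iff
          intro!: add_nonneg_nonneg mult_nonneg_nonneg)
    finally show ?thesis .
  qed
  then show ?thesis
    unfolding expected_pivot_steps_def input_law_def N_def[symmetric] b_def[symmetric] c_def[symmetric]
    by (intro nn_integral_pair_le uniform_sphere.prob_space_axioms prob_space_imp_sigma_finite prob_space_PiM)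
qed

text \<open>A grid net of the unit ball, reduced to its members near the sphere. The member that
  approximates a unit vector is itself near the sphere, so it survives the reduction.\<close>

lemma sphere_net:
  assumes \<delta>: "0 < \<delta>"
  obtains G :: "(real ^ 'n) set" where "finite G" "real (card G) \<le> (8 * real CARD('n) / \<delta> + 3) ^ CARD('n)"
    "\<And>g. g \<in> G \<Longrightarrow> \<exists>u. norm u = 1 \<and> dist u g \<le> \<delta> / 4"
    "\<And>u. norm u = 1 \<Longrightarrow> \<exists>g\<in>G. dist u g \<le> \<delta> / 4"
proof -
  let ?n = "CARD('n)"
  define M where "M = nat \<lceil>4 * real ?n / \<delta>\<rceil>"
  have pos: "4 * real ?n / \<delta> > 0" using \<delta> by simp
  then have M1: "4 * real ?n / \<delta> \<le> real M" and M2: "real M \<le> 4 * real ?n / \<delta> + 1"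
    using real_nat_ceiling_ge[of "4 * real ?n / \<delta>"] of_int_ceiling_le_add_one[of "4 * real ?n / \<delta>"]
    by (simp_all add: M_def of_nat_nat)
  have M0: "M > 0" using pos M1 by linarith
  obtain G :: "(real^'n) set" where G: "finite G" "card G \<le> (2 * M + 1) ^ dim (UNIV :: (real^'n) set)"
    "\<And>x. x \<in> UNIV \<Longrightarrow> norm x \<le> 1 \<Longrightarrow> \<exists>g\<in>G. dist x g \<le> real (dim (UNIV :: (real^'n) set)) / real M"
    using subspace_net[OF subspace_UNIV M0] by metis
  have dim: "dim (UNIV :: (real^'n) set) = ?n" by (simp add: dim_UNIV)
  define H where "H = {g \<in> G. \<exists>u. norm u = 1 \<and> dist u g \<le> \<delta> / 4}"
  have "real ?n / real M \<le> \<delta> / 4" using M1 M0 \<delta> by (simp add: field_simps)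
  then have "\<exists>g\<in>H. dist u g \<le> \<delta> / 4" if u: "norm u = 1" for u
  proof -
    obtain g where "g \<in> G" "dist u g \<le> real ?n / real M" using G(3)[of u] u dim by auto
    moreover from this have "dist u g \<le> \<delta> / 4" using \<open>real ?n / real M \<le> \<delta> / 4\<close> by linarith
    ultimately show ?thesis using u by (auto simp: H_def)
  qed
  moreover have "card H \<le> card G" unfolding H_def using G(1) by (intro card_mono) auto
  then have "real (card H) \<le> real ((2 * M + 1) ^ ?n)"
    using G(2) dim by (simp only: of_nat_le_iff)
  moreover have "real ((2 * M + 1) ^ ?n) \<le> (8 * real ?n / \<delta> + 3) ^ ?n"
    unfolding of_nat_power using M2 by (intro power_mono) auto
  ultimately show thesis
    using that[of H] G(1) by (auto simp: H_def)
qed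

text \<open>\<open>K\<close> is chosen to make the exponential equal to \<open>m\<close> to the power \<open>- (2 n + 2)\<close>, which beats the trivial bound on the number of edges.\<close>
lemma steps_bound:
  fixes n m :: nat and K \<delta> g :: real
  assumes n: "n \<ge> 2" and m: "m \<ge> 1" and lnm: "ln (real m) \<ge> 1"
    and K: "K = (2 * real n + 2) / (8 / (real n * 16 ^ n))" and KL: "K * ln (real m) \<ge> 1"
    and small: "K * ln (real m) / real m \<le> (1 / 4) ^ (n - 1)"
    and \<delta>_def: "\<delta> = (K * ln (real m) / real m) powr (1 / (real n - 1))"
    and g: "0 \<le> g" "g \<le> (8 * real n / \<delta> + 3) ^ n"
  shows "0 < \<delta>" "\<delta> \<le> 1 / 4"
    "real n * (real (card (index_sets {0..m} (n + 1))) *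
       (g * exp (- real m * (8 / (real n * 16 ^ n) * \<delta> ^ (n - 1)))) +
     25 * 8 ^ n * \<delta> ^ (n - 2) * (real m * (\<Sum>s\<le>n. (real m * (8 ^ n * \<delta> ^ (n - 1))) ^ s)))
     \<le> real n * (real (n + 2) * 2 ^ (n + 1) * (11 * real n) ^ n + 25 * 8 ^ n * K * (real (n + 1) * (8 ^ n * K) ^ n))
        * real m powr (1 / (real n - 1)) * ln (real m) ^ (n + 1)"
proof -
  define L where "L = ln (real m)"
  define x where "x = K * L / real m"
  define P where "P = real m powr (1 / (real n - 1))"
  define p where "p = 8 / (real n * 16 ^ n)"
  have m0: "real m \<ge> 1" using m by simp
  have p0: "p > 0" using n by (simp add: p_def)
  have pK: "p * K = 2 * real n + 2" using p0 by (simp add: K p_def[symmetric])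
  have L1: "L \<ge> 1" using lnm by (simp add: L_def)
  have KL1: "K * L \<ge> 1" using KL by (simp add: L_def)
  have x0: "x > 0" using KL1 m0 by (simp add: x_def)
  have mx: "real m * x = K * L" using m0 by (simp add: x_def)
  have \<delta>x: "\<delta> = x powr (1 / (real n - 1))" by (simp add: \<delta>_def x_def L_def)
  show \<delta>0: "0 < \<delta>" using x0 by (simp add: \<delta>x)
  have \<delta>p: "\<delta> ^ (n - 1) = x"
    using \<delta>0 x0 n by (simp add: \<delta>x powr_realpow[symmetric] powr_powr of_nat_diff)
  show \<delta>4: "\<delta> \<le> 1 / 4"
  proof (rule ccontr)
    assume "\<not> \<delta> \<le> 1 / 4"
    then have "(1 / 4) ^ (n - 1) < \<delta> ^ (n - 1)" using n by (intro power_strict_mono) auto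
    then show False using small \<delta>p by (simp add: x_def L_def)
  qed
  have "1 \<le> P" unfolding P_def using m0 n by (intro ge_one_powr_ge_zero) auto
  \<comment> \<open>Since \<delta> is below 1, the power \<open>x\<close> of it is no larger. This
    yields the crude bound \<open>1 / \<delta> \<le> m\<close>, enough for the size of the
    net.\<close>
  have "x \<le> \<delta>"
    using power_decreasing[of 1 "n - 1" \<delta>] \<delta>0 \<delta>4 n \<delta>p by simp
  then have "1 / \<delta> \<le> 1 / x" using x0 by (simp add: frac_le)
  also have "1 / x \<le> real m" using KL1 m0 x0 mx by (simp add: field_simps)
  finally have inv\<delta>: "1 / \<delta> \<le> real m" .
  have inv\<delta>P: "1 / \<delta> \<le> P"
  proof -
    have "1 / \<delta> = (1 / x) powr (1 / (real n - 1))"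
      using x0 by (simp add: \<delta>x powr_divide)
    also have "\<dots> \<le> P"
      unfolding P_def using \<open>1 / x \<le> real m\<close> x0 n by (intro powr_mono2) auto
    finally show ?thesis .
  qed
  have "8 * real n / \<delta> + 3 \<le> 11 * real n * real m"
  proof -
    have "8 * real n * (1 / \<delta>) \<le> 8 * real n * real m" using inv\<delta> by (intro mult_left_mono) auto
    moreover have "1 * 1 \<le> real n * real m" using n m0 by (intro mult_mono) auto
    ultimately show ?thesis by simp
  qed
  then have "(8 * real n / \<delta> + 3) ^ n \<le> (11 * real n * real m) ^ n"
    using \<delta>0 by (intro power_mono) auto
  then have g': "g \<le> (11 * real n) ^ n * real m ^ n" using g by (simp add: power_mult_distrib)
  have "real (card (index_sets {0..m} (n + 1))) \<le> real ((n + 2) * (m + 1) ^ (n + 1))"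
    using card_index_sets_le[of "{0..m}" "n + 1"] by (simp only: of_nat_le_iff) simp
  also have "\<dots> \<le> real (n + 2) * (2 * real m) ^ (n + 1)"
    unfolding of_nat_mult of_nat_power using m0 by (intro mult_left_mono power_mono) auto
  also have "\<dots> = real (n + 2) * 2 ^ (n + 1) * real m ^ (n + 1)" by (simp only: power_mult_distrib mult.assoc)
  finally have N: "real (card (index_sets {0..m} (n + 1))) \<le> real (n + 2) * 2 ^ (n + 1) * real m ^ (n + 1)" .
  have ex: "exp (- real m * (p * x)) = 1 / real m ^ (2 * n + 2)"
  proof -
    have "real m * (p * x) = p * K * L" using mx by (metis mult.assoc mult.left_commute)
    also have "\<dots> = real (2 * n + 2) * L" by (simp add: pK)
    finally have "- real m * (p * x) = - (real (2 * n + 2) * L)" by simp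
    then have "exp (- real m * (p * x)) = inverse (exp (real (2 * n + 2) * L))" by (simp only: exp_minus)
    also have "exp (real (2 * n + 2) * L) = real m ^ (2 * n + 2)"
      using m0 by (simp only: exp_of_nat_mult L_def) (simp add: exp_ln)
    finally show ?thesis by (simp add: inverse_eq_divide)
  qed
  define D where "D = real (n + 2) * 2 ^ (n + 1) * (11 * real n) ^ n"
  have D0: "D \<ge> 0" by (simp add: D_def)
  have pw: "real m ^ (2 * n + 1) = real m ^ (n + 1) * real m ^ n"
    by (subst power_add[symmetric]) (rule arg_cong[where f="\<lambda>k. real m ^ k"], simp)
  \<comment> \<open>Index sets contribute \<open>m ^ (n + 1)\<close> and the net
    \<open>m ^ n\<close>; together the exponent \<open>2 * n + 1\<close> stays below the
    \<open>2 * n + 2\<close> of the exponential.\<close>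
  have "real (card (index_sets {0..m} (n + 1))) * (g * exp (- real m * (p * x)))
      \<le> (real (n + 2) * 2 ^ (n + 1) * real m ^ (n + 1)) * ((11 * real n) ^ n * real m ^ n * (1 / real m ^ (2 * n + 2)))"
    unfolding ex using N g' g by (intro mult_mono) auto
  also have "\<dots> = D * (real m ^ (2 * n + 1) / real m ^ (2 * n + 2))"
    unfolding D_def pw
    by (simp only: times_divide_eq_right times_divide_eq_left mult_1_left mult_1_right mult_ac)
  also have "real m ^ (2 * n + 1) / real m ^ (2 * n + 2) \<le> 1"
    using power_increasing[of "2 * n + 1" "2 * n + 2" "real m"] m0 by simp
  then have "D * (real m ^ (2 * n + 1) / real m ^ (2 * n + 2)) \<le> D * 1"
    using D0 by (intro mult_left_mono)
  also have "D * 1 \<le> D * (P * L ^ (n + 1))"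
    using mult_mono[OF \<open>1 \<le> P\<close> one_le_power[OF L1, of "n + 1"]] D0 \<open>1 \<le> P\<close> by (intro mult_left_mono) auto
  finally have b1: "real (card (index_sets {0..m} (n + 1))) * (g * exp (- real m * (p * x))) \<le> D * (P * L ^ (n + 1))" .
  \<comment> \<open>The source of the main term: \<open>m * \<delta> ^ (n - 1)\<close> equals
    \<open>K * L\<close>, so one missing factor \<delta> leaves \<open>1 / \<delta>\<close>, which
    is at most \<open>P\<close>.\<close>
  have "\<delta> ^ (n - 2) * real m = K * L * (1 / \<delta>)"
  proof -
    have "\<delta> * \<delta> ^ (n - 2) = x" using n \<delta>p by (metis Suc_1 Suc_diff_le diff_Suc_Suc power_Suc)
    then have "\<delta> ^ (n - 2) = x / \<delta>" using \<delta>0 by (simp add: field_simps)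
    then show ?thesis using mx by (simp add: mult.commute)
  qed
  also have "\<dots> \<le> K * L * P" using inv\<delta>P KL1 by (intro mult_left_mono) auto
  finally have dm: "\<delta> ^ (n - 2) * real m \<le> K * L * P" .
  let ?q = "8 ^ n * K * L"
  have q1: "1 \<le> ?q"
    using mult_mono[of 1 "8 ^ n" 1 "K * L"] KL1 by simp
  \<comment> \<open>The expected number of points in a ball is of order \<open>L\<close>, so the sum
    costs only \<open>L ^ n\<close>. With the factor \<open>L\<close> from the main term, the
    logarithm has exponent \<open>n + 1\<close>.\<close>
  have "(\<Sum>s\<le>n. ?q ^ s) \<le> (\<Sum>s\<le>n. ?q ^ n)"
    using q1 by (intro sum_mono power_increasing) auto
  also have "\<dots> = real (n + 1) * (8 ^ n * K) ^ n * L ^ n" by (simp add: power_mult_distrib)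
  finally have sq: "(\<Sum>s\<le>n. ?q ^ s) \<le> real (n + 1) * (8 ^ n * K) ^ n * L ^ n" .
  have "real m * (8 ^ n * x) = ?q" using mx by (metis mult.assoc mult.left_commute)
  then have "25 * 8 ^ n * \<delta> ^ (n - 2) * (real m * (\<Sum>s\<le>n. (real m * (8 ^ n * x)) ^ s))
      = 25 * 8 ^ n * ((\<delta> ^ (n - 2) * real m) * (\<Sum>s\<le>n. ?q ^ s))"
    by (simp only: mult.assoc)
  also have "\<dots> \<le> 25 * 8 ^ n * ((K * L * P) * (real (n + 1) * (8 ^ n * K) ^ n * L ^ n))"
    using dm sq q1 KL1 \<open>1 \<le> P\<close>
    by (intro mult_left_mono mult_mono[where a="\<delta> ^ (n - 2) * real m"]) (auto intro!: sum_nonneg zero_le_power simp del: of_nat_add)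
  also have "\<dots> = 25 * 8 ^ n * K * (real (n + 1) * (8 ^ n * K) ^ n) * (P * L ^ (n + 1))"
    by (simp add: mult_ac)
  finally have b2: "25 * 8 ^ n * \<delta> ^ (n - 2) * (real m * (\<Sum>s\<le>n. (real m * (8 ^ n * x)) ^ s))
      \<le> 25 * 8 ^ n * K * (real (n + 1) * (8 ^ n * K) ^ n) * (P * L ^ (n + 1))" .
  have "real n * (real (card (index_sets {0..m} (n + 1))) * (g * exp (- real m * (p * x))) +
      25 * 8 ^ n * \<delta> ^ (n - 2) * (real m * (\<Sum>s\<le>n. (real m * (8 ^ n * x)) ^ s)))
      \<le> real n * (D * (P * L ^ (n + 1)) + 25 * 8 ^ n * K * (real (n + 1) * (8 ^ n * K) ^ n) * (P * L ^ (n + 1)))"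
    using b1 b2 by (intro mult_left_mono add_mono) auto
  also have "\<dots> = real n * (D + 25 * 8 ^ n * K * (real (n + 1) * (8 ^ n * K) ^ n)) * P * L ^ (n + 1)"
    by (simp only: distrib_right mult.assoc)
  finally show "real n * (real (card (index_sets {0..m} (n + 1))) *
       (g * exp (- real m * (8 / (real n * 16 ^ n) * \<delta> ^ (n - 1)))) +
     25 * 8 ^ n * \<delta> ^ (n - 2) * (real m * (\<Sum>s\<le>n. (real m * (8 ^ n * \<delta> ^ (n - 1))) ^ s)))
     \<le> real n * (real (n + 2) * 2 ^ (n + 1) * (11 * real n) ^ n + 25 * 8 ^ n * K * (real (n + 1) * (8 ^ n * K) ^ n))
        * real m powr (1 / (real n - 1)) * ln (real m) ^ (n + 1)"
    unfolding \<delta>p p_def D_def P_def L_def .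
qed

theorem theorem5:
  fixes n :: nat
  assumes "n = CARD('n::finite)" and "n \<ge> 2"
  shows "\<exists>(C::real) (k::nat). \<forall>\<^sub>F m in sequentially.
           \<forall>e :: nat \<Rightarrow> real ^ 'n. bij_betw e {1..n} Basis \<longrightarrow>
             expected_pivot_steps e m
               \<le> ennreal (C * real m powr (1 / (real n - 1)) * ln (real m) ^ k)"
proof -
  define K where "K = (2 * real n + 2) / (8 / (real n * 16 ^ n))"
  have K0: "K > 0" unfolding K_def using assms(2) by (intro divide_pos_pos) auto
  define C where "C = real n * (real (n + 2) * 2 ^ (n + 1) * (11 * real n) ^ n +
    25 * 8 ^ n * K * (real (n + 1) * (8 ^ n * K) ^ n))"
  have "\<forall>\<^sub>F m in sequentially. m \<ge> (1::nat)" by (rule eventually_ge_at_top)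
  moreover have lnt: "filterlim (\<lambda>m. ln (real m)) at_top sequentially"
    by (rule filterlim_compose[OF ln_at_top filterlim_real_sequentially])
  then have "\<forall>\<^sub>F m in sequentially. 1 \<le> ln (real m)" "\<forall>\<^sub>F m in sequentially. 1 / K \<le> ln (real m)"
    by (simp_all add: filterlim_at_top)
  moreover have "(\<lambda>m. K * (ln (real m) / real m)) \<longlonglongrightarrow> K * 0"
    using lim_ln_over_n by (intro tendsto_mult tendsto_const)
  then have "\<forall>\<^sub>F m in sequentially. K * (ln (real m) / real m) < (1 / 4) ^ (n - 1)"
    by (rule order_tendstoD) simp
  ultimately have "\<forall>\<^sub>F m in sequentially. \<forall>e :: nat \<Rightarrow> real ^ 'n. bij_betw e {1..n} Basis \<longrightarrow>
      expected_pivot_steps e m \<le> ennreal (C * real m powr (1 / (real n - 1)) * ln (real m) ^ (n + 1))"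
  \<comment> \<open>The eventual conditions concern \<open>m\<close> alone, so one threshold serves
    all enumerations \<open>e\<close>. The last of them ensures
    \<open>\<delta> \<le> 1 / 4\<close>.\<close>
  proof eventually_elim
    case (elim m)
    have KL: "K * ln (real m) \<ge> 1" using elim(3) K0 by (simp add: field_simps)
    have small: "K * ln (real m) / real m \<le> (1 / 4) ^ (n - 1)" using elim(4) by simp
    define \<delta> where "\<delta> = (K * ln (real m) / real m) powr (1 / (real n - 1))"
    have "K * ln (real m) / real m > 0" using KL elim(1) by (intro divide_pos_pos) auto
    then have "0 < \<delta>" by (simp only: \<delta>_def powr_gt_zero)
    then obtain G :: "(real ^ 'n) set" where G: "finite G" "real (card G) \<le> (8 * real n / \<delta> + 3) ^ n"
      "\<And>g. g \<in> G \<Longrightarrow> \<exists>u. norm u = 1 \<and> dist u g \<le> \<delta> / 4"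
      "\<And>u. norm u = 1 \<Longrightarrow> \<exists>g\<in>G. dist u g \<le> \<delta> / 4"
      using sphere_net[of \<delta>, where 'n='n] assms(1) by metis
    note bound = steps_bound[OF assms(2) elim(1,2) K_def KL small \<delta>_def of_nat_0_le_iff G(2)]
    show ?case
    proof (intro allI impI)
      fix e :: "nat \<Rightarrow> real ^ 'n" assume e: "bij_betw e {1..n} Basis"
      have "CARD('n) \<ge> 2" "bij_betw e {1..CARD('n)} Basis" using assms e by auto
      note expected_pivot_steps_le[OF this(2,1) G(1,3,4) bound(1,2), of m]
      also note ennreal_leI[OF bound(3)[unfolded assms(1)]]
      finally show "expected_pivot_steps e m \<le> ennreal (C * real m powr (1 / (real n - 1)) * ln (real m) ^ (n + 1))"
        by (simp only: C_def assms(1))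
    qed
  qed
  then show ?thesis by blast
qed

end
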